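(* Let $\mathcal{B}$ be a simple body whose material groupoid $\Omega(\mathcal{B})$ is a Lie subgroupoid of $\Pi^1(\mathcal{B},\mathcal{B})$. Then $\mathcal{B}$ is uniform if and only if the material algebroid $A\Omega(\mathcal{B})$ is transitive.
   Context: 1-jets groupoid: for a manifold $M$, $\Pi^1(M,M)$ is the set of 1-jets $j^1_{x,y}\phi$ of local diffeomorphisms $\phi$ of $M$ with $\phi(x)=y$; it is a Lie groupoid over $M$ with source $\alpha(j^1_{x,y}\phi)=x$, target $\beta(j^1_{x,y}\phi)=y$, identities $\epsilon(x)=j^1_{x,x}\mathrm{Id}$ and composition of jets. (Simple) body: a three-dimensional manifold $\mathcal{B}$ which can be covered by one chart, identified with an open subset of $\mathbb{R}^3$ by a fixed embedding (reference configuration). A deformation is an embedding $\kappa:\mathcal{B}\to\mathbb{R}^3$; an infinitesimal deformation at $Y$ is its 1-jet $j^1_{Y,\kappa(Y)}\kappa$. The body is equipped with a response functional: a differentiable map $W:\Pi^1(\mathcal{B},\mathcal{B})\to V$, $V$ a real vector space, such that $W(j^1_{X,Y}\phi)=W(j^1_{X,Z}(\tau_{Z-Y}\circ\phi))$ for all $X,Y,Z\in\mathcal{B}$ and all $j^1_{X,Y}\phi$, where $\tau_v$ is translation of $\mathbb{R}^3$ by $v$. By this invariance $W$ extends to 1-jets of local diffeomorphisms from points of $\mathcal{B}$ to points of $\mathbb{R}^3$. Material isomorphism: a jet $j^1_{X,Y}\psi\in\Pi^1(\mathcal{B},\mathcal{B})$ with $W(j^1_{Y,\kappa(Y)}\kappa\cdot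 j^1_{X,Y}\psi)=W(j^1_{Y,\kappa(Y)}\kappa)$ for every infinitesimal deformation $j^1_{Y,\kappa(Y)}\kappa$ at $Y$. $\Omega(\mathcal{B})\subseteq\Pi^1(\mathcal{B},\mathcal{B})$ is the subgroupoid (over $\mathcal{B}$) of all material isomorphisms. $\mathcal{B}$ is uniform if for all $X,Y\in\mathcal{B}$ there is a material isomorphism from $X$ to $Y$. Standing assumption: $\Omega(\mathcal{B})$ is a Lie subgroupoid of $\Pi^1(\mathcal{B},\mathcal{B})$; it is called the material groupoid. Lie algebroid of a Lie groupoid $\Gamma\rightrightarrows M$: the vector bundle $A\Gamma\to M$ with fibre $\ker T_{\epsilon(x)}\beta$ at $x$, with anchor $\sharp=T\alpha|_{A\Gamma}:A\Gamma\to TM$ and with the bracket of sections induced by identifying sections with left-invariant vector fields on $\Gamma$. The material algebroid is $A\Omega(\mathcal{B})\subseteq A\Pi^1(\mathcal{B},\mathcal{B})$. A Lie algebroid is transitive if its anchor is surjective.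
   Formalization: The body is additionally assumed connected; otherwise the claim fails, e.g. for two disjoint balls with W = det F on jets from the first and exp(det F) on jets from the second, where the material algebroid is transitive but the body is not uniform. *)

theory Defs
  imports "HOL-Analysis.Analysis"
begin

section \<open>Smooth maps between open subsets of Euclidean spaces\<close>

text \<open>Intended for open \<open>S\<close>, where this is the usual definition of class \<open>C\<^sup>k\<close>.\<close>

primrec Ck_on :: "nat \<Rightarrow> 'a::euclidean_space set \<Rightarrow> ('a \<Rightarrow> 'b::real_normed_vector) \<Rightarrow> bool" where
  "Ck_on 0 S f \<longleftrightarrow> continuous_on S f"
| "Ck_on (Suc k) S f \<longleftrightarrow>
     (\<forall>x\<in>S. f differentiable (at x)) \<and> (\<forall>v. Ck_on k S (\<lambda>x. frechet_derivative f (at x) v))"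

definition smooth_on :: "'a::euclidean_space set \<Rightarrow> ('a \<Rightarrow> 'b::real_normed_vector) \<Rightarrow> bool" where
  "smooth_on S f \<longleftrightarrow> (\<forall>k. Ck_on k S f)"

lemma Ck_on_const: "Ck_on k S (\<lambda>x. c)"
  by (induction k arbitrary: c) (simp_all add: continuous_on_const)

lemma smooth_on_affine:
  assumes "linear f"
  shows "smooth_on S (\<lambda>x::'a::euclidean_space. f x + (c::'b::euclidean_space))"
  unfolding smooth_on_def
proof
  fix k
  have bl: "bounded_linear f" using assms by (simp add: linear_conv_bounded_linear)
  have hd: "((\<lambda>x. f x + c) has_derivative f) (at x)" for x
    using bounded_linear_imp_has_derivative[OF bl] by (auto intro!: derivative_eq_intros)
  have fd: "frechet_derivative (\<lambda>x. f x + c) (at x) = f" for x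
    using frechet_derivative_at[OF hd] by simp
  show "Ck_on k S (\<lambda>x. f x + c)"
  proof (cases k)
    case 0
    then show ?thesis using has_derivative_continuous_on[of S "\<lambda>x. f x + c" "\<lambda>_. f"] hd
      by (simp add: has_derivative_at_withinI)
  next
    case (Suc m)
    then show ?thesis using hd by (auto simp: fd Ck_on_const differentiable_def)
  qed
qed

definition diffeomorphism ::
    "'a::euclidean_space set \<Rightarrow> 'b::euclidean_space set \<Rightarrow> ('a \<Rightarrow> 'b) \<Rightarrow> bool" where
  "diffeomorphism U V \<phi> \<longleftrightarrow>
     open U \<and> open V \<and> (\<exists>\<psi>. homeomorphism U V \<phi> \<psi> \<and> smooth_on U \<phi> \<and> smooth_on V \<psi>)"

section \<open>Immersed submanifolds of Euclidean spaces\<close>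

definition embedded_submanifold :: "nat \<Rightarrow> 'a::euclidean_space set \<Rightarrow> bool" where
  "embedded_submanifold k S \<longleftrightarrow>
     (\<forall>p\<in>S. \<exists>U V (\<phi>::'a \<Rightarrow> 'a) L.
        p \<in> U \<and> diffeomorphism U V \<phi> \<and> subspace L \<and> dim L = k \<and> \<phi> ` (U \<inter> S) = V \<inter> L)"

text \<open>
  A submanifold is represented by its own topology \<open>T\<close>, whose underlying set is \<open>topspace T\<close> and which
  may be finer than the topology induced by the ambient space: it is locally embedded. This is
  equivalent to giving \<open>topspace T\<close> a smooth structure for which the inclusion is an injective
  immersion. The embedded submanifolds \<open>S\<close> are the case \<open>T = top_of_set S\<close>.
\<close>

definition submanifold :: "nat \<Rightarrow> 'a::euclidean_space topology \<Rightarrow> bool" where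
  "submanifold k T \<longleftrightarrow>
     second_countable T \<and>
     (\<forall>p\<in>topspace T. \<exists>U. openin T U \<and> p \<in> U \<and>
        embedded_submanifold k U \<and> subtopology T U = top_of_set U)"

definition smooth_map ::
    "'a::euclidean_space topology \<Rightarrow> 'b::euclidean_space topology \<Rightarrow> ('a \<Rightarrow> 'b) \<Rightarrow> bool" where
  "smooth_map T T' f \<longleftrightarrow>
     continuous_map T T' f \<and>
     (\<forall>p\<in>topspace T. \<exists>U N F. openin T U \<and> p \<in> U \<and> open N \<and> U \<subseteq> N \<and>
        smooth_on N F \<and> (\<forall>q\<in>U. F q = f q))"

definition tangent_curve ::
    "'a::euclidean_space topology \<Rightarrow> 'a \<Rightarrow> 'a \<Rightarrow> (real \<Rightarrow> 'a) \<Rightarrow> bool" where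
  "tangent_curve T p v \<gamma> \<longleftrightarrow>
     (\<exists>e>0. continuous_map (top_of_set {-e<..<e}) T \<gamma> \<and> smooth_on {-e<..<e} \<gamma>) \<and>
     \<gamma> 0 = p \<and> (\<gamma> has_vector_derivative v) (at 0)"

definition tangent_space :: "'a::euclidean_space topology \<Rightarrow> 'a \<Rightarrow> 'a set" where
  "tangent_space T p = {v. \<exists>\<gamma>. tangent_curve T p v \<gamma>}"

text \<open>
  \<open>T\<^sub>pf(v)\<close>, meaningful for \<open>v\<close> in \<open>tangent_space T p\<close> and \<open>f\<close> smooth on the submanifold \<open>T\<close>; only the
  values of \<open>f\<close> on \<open>topspace T\<close> near \<open>p\<close> matter.
\<close>

definition tangent_map ::
    "'a::euclidean_space topology \<Rightarrow> ('a \<Rightarrow> 'b::euclidean_space) \<Rightarrow> 'a \<Rightarrow> 'a \<Rightarrow> 'b" where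
  "tangent_map T f p v =
     (THE w. \<exists>\<gamma>. tangent_curve T p v \<gamma> \<and> ((f \<circ> \<gamma>) has_vector_derivative w) (at 0))"

lemma tangent_map_linear:
  fixes f :: "'a::euclidean_space \<Rightarrow> 'b::euclidean_space"
  assumes "linear f" "v \<in> tangent_space T p"
  shows "tangent_map T f p v = f v"
  unfolding tangent_map_def
proof (rule the_equality)
  have bl: "bounded_linear f" using assms by (simp add: linear_conv_bounded_linear)
  have k: "((f \<circ> \<gamma>) has_vector_derivative f v) (at 0)" if "tangent_curve T p v \<gamma>" for \<gamma>
    using that bounded_linear.has_vector_derivative[OF bl] by (auto simp: tangent_curve_def o_def)
  then show "\<exists>\<gamma>. tangent_curve T p v \<gamma> \<and> (f \<circ> \<gamma> has_vector_derivative f v) (at 0)"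
    using assms by (auto simp: tangent_space_def)
  show "w = f v" if "\<exists>\<gamma>. tangent_curve T p v \<gamma> \<and> (f \<circ> \<gamma> has_vector_derivative w) (at 0)" for w
    using that k vector_derivative_unique_at by blast
qed

definition submersion ::
    "'a::euclidean_space topology \<Rightarrow> 'b::euclidean_space topology \<Rightarrow> ('a \<Rightarrow> 'b) \<Rightarrow> bool" where
  "submersion T T' f \<longleftrightarrow>
     smooth_map T T' f \<and>
     (\<forall>p\<in>topspace T. tangent_map T f p ` tangent_space T p = tangent_space T' (f p))"

definition injective_immersion ::
    "'a::euclidean_space topology \<Rightarrow> 'b::euclidean_space topology \<Rightarrow> ('a \<Rightarrow> 'b) \<Rightarrow> bool" where
  "injective_immersion T T' f \<longleftrightarrow>
     smooth_map T T' f \<and> inj_on f (topspace T) \<and>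
     (\<forall>p\<in>topspace T. inj_on (tangent_map T f p) (tangent_space T p))"

text \<open>
  Vector fields are functions into the ambient space with values in the tangent spaces, so that the
  Lie bracket is \<open>[X,Y] = DY(X) - DX(Y)\<close>.
\<close>

definition lie_bracket ::
    "'a::euclidean_space topology \<Rightarrow> ('a \<Rightarrow> 'a) \<Rightarrow> ('a \<Rightarrow> 'a) \<Rightarrow> 'a \<Rightarrow> 'a" where
  "lie_bracket T X Y p = tangent_map T Y p (X p) - tangent_map T X p (Y p)"

section \<open>Lie groupoids\<close>

text \<open>
  The product \<open>mult G g h\<close> is defined when \<open>source G g = target G h\<close> (first \<open>h\<close>, then \<open>g\<close>).
\<close>

record ('g, 'm) groupoid_data =
  arrows :: "'g topology"
  objects :: "'m topology"
  source :: "'g \<Rightarrow> 'm"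
  target :: "'g \<Rightarrow> 'm"
  ident :: "'m \<Rightarrow> 'g"
  mult :: "'g \<Rightarrow> 'g \<Rightarrow> 'g"
  ginv :: "'g \<Rightarrow> 'g"

definition groupoid :: "('g, 'm) groupoid_data \<Rightarrow> bool" where
  "groupoid G \<longleftrightarrow>
     (\<forall>g\<in>topspace (arrows G).
        source G g \<in> topspace (objects G) \<and> target G g \<in> topspace (objects G)) \<and>
     (\<forall>x\<in>topspace (objects G).
        ident G x \<in> topspace (arrows G) \<and> source G (ident G x) = x \<and> target G (ident G x) = x) \<and>
     (\<forall>g\<in>topspace (arrows G). \<forall>h\<in>topspace (arrows G). source G g = target G h \<longrightarrow>
        mult G g h \<in> topspace (arrows G) \<and>
        source G (mult G g h) = source G h \<and> target G (mult G g h) = target G g) \<and>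
     (\<forall>g\<in>topspace (arrows G). \<forall>h\<in>topspace (arrows G). \<forall>k\<in>topspace (arrows G).
        source G g = target G h \<longrightarrow> source G h = target G k \<longrightarrow>
        mult G (mult G g h) k = mult G g (mult G h k)) \<and>
     (\<forall>g\<in>topspace (arrows G).
        mult G g (ident G (source G g)) = g \<and> mult G (ident G (target G g)) g = g) \<and>
     (\<forall>g\<in>topspace (arrows G).
        ginv G g \<in> topspace (arrows G) \<and>
        source G (ginv G g) = target G g \<and> target G (ginv G g) = source G g \<and>
        mult G g (ginv G g) = ident G (target G g) \<and> mult G (ginv G g) g = ident G (source G g))"

definition composable_pairs :: "('g, 'm) groupoid_data \<Rightarrow> ('g \<times> 'g) topology" where
  "composable_pairs G =
     subtopology (prod_topology (arrows G) (arrows G)) {(g, h). source G g = target G h}"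

definition lie_groupoid ::
    "('g::euclidean_space, 'm::euclidean_space) groupoid_data \<Rightarrow> bool" where
  "lie_groupoid G \<longleftrightarrow>
     groupoid G \<and>
     (\<exists>k. submanifold k (arrows G)) \<and> (\<exists>k. submanifold k (objects G)) \<and>
     submersion (arrows G) (objects G) (source G) \<and>
     submersion (arrows G) (objects G) (target G) \<and>
     smooth_map (objects G) (arrows G) (ident G) \<and>
     smooth_map (composable_pairs G) (arrows G) (\<lambda>(g, h). mult G g h) \<and>
     smooth_map (arrows G) (arrows G) (ginv G)"

definition lie_subgroupoid ::
    "('g::euclidean_space, 'm::euclidean_space) groupoid_data \<Rightarrow> ('g, 'm) groupoid_data \<Rightarrow> bool"
  where
  "lie_subgroupoid H G \<longleftrightarrow>
     lie_groupoid H \<and>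
     injective_immersion (arrows H) (arrows G) id \<and>
     injective_immersion (objects H) (objects G) id \<and>
     (\<forall>g\<in>topspace (arrows H).
        source H g = source G g \<and> target H g = target G g \<and> ginv H g = ginv G g) \<and>
     (\<forall>x\<in>topspace (objects H). ident H x = ident G x) \<and>
     (\<forall>g\<in>topspace (arrows H). \<forall>h\<in>topspace (arrows H). source H g = target H h \<longrightarrow>
        mult H g h = mult G g h)"

section \<open>The Lie algebroid of a Lie groupoid\<close>

record ('a, 'm) algebroid_data =
  base :: "'m topology"
  fibre :: "'m \<Rightarrow> 'a set"
  anchor :: "'m \<Rightarrow> 'a \<Rightarrow> 'm"
  bracket :: "('m \<Rightarrow> 'a) \<Rightarrow> ('m \<Rightarrow> 'a) \<Rightarrow> 'm \<Rightarrow> 'a"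

text \<open>
  The value at \<open>g\<close> of the left-invariant vector field determined by the section \<open>s\<close>. Left translation
  by \<open>g\<close> is only defined on the \<open>\<beta>\<close>-fibre over \<open>\<alpha>(g)\<close>, whose tangent space at the identity contains
  \<open>s(\<alpha>(g))\<close>.
\<close>

definition left_invariant_field ::
    "('g::euclidean_space, 'm::euclidean_space) groupoid_data \<Rightarrow> ('m \<Rightarrow> 'g) \<Rightarrow> 'g \<Rightarrow> 'g" where
  "left_invariant_field G s g =
     tangent_map (subtopology (arrows G) {h. target G h = source G g})
       (mult G g) (ident G (source G g)) (s (source G g))"

definition lie_algebroid ::
    "('g::euclidean_space, 'm::euclidean_space) groupoid_data \<Rightarrow> ('g, 'm) algebroid_data" where
  "lie_algebroid G =
     \<lparr>base = objects G,
      fibre = (\<lambda>x. {v \<in> tangent_space (arrows G) (ident G x).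
                    tangent_map (arrows G) (target G) (ident G x) v = 0}),
      anchor = (\<lambda>x. tangent_map (arrows G) (source G) (ident G x)),
      bracket = (\<lambda>s t x. lie_bracket (arrows G)
                   (left_invariant_field G s) (left_invariant_field G t) (ident G x))\<rparr>"

definition transitive_algebroid :: "('a, 'm::euclidean_space) algebroid_data \<Rightarrow> bool" where
  "transitive_algebroid A \<longleftrightarrow>
     (\<forall>x\<in>topspace (base A). anchor A x ` fibre A x = tangent_space (base A) x)"

section \<open>The groupoid of 1-jets\<close>

text \<open>
  On open subsets of \<open>real ^ 'n\<close>, the 1-jet of \<open>\<phi>\<close> at \<open>x\<close> is given by the source \<open>x\<close>, the target \<open>\<phi> x\<close>
  and the Jacobian matrix at \<open>x\<close>.
\<close>

type_synonym 'n jet = "(real ^ 'n) \<times> (real ^ 'n) \<times> (real ^ 'n ^ 'n)"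

definition jet :: "(real ^ 'n \<Rightarrow> real ^ 'n) \<Rightarrow> real ^ 'n \<Rightarrow> 'n::finite jet" where
  "jet \<phi> x = (x, \<phi> x, matrix (frechet_derivative \<phi> (at x)))"

fun jet_source :: "'n::finite jet \<Rightarrow> real ^ 'n" where
  "jet_source (x, y, A) = x"

fun jet_target :: "'n::finite jet \<Rightarrow> real ^ 'n" where
  "jet_target (x, y, A) = y"

fun jet_comp :: "'n::finite jet \<Rightarrow> 'n jet \<Rightarrow> 'n jet" where
  "jet_comp (y, z, A) (x, y', C) = (x, z, A ** C)"

fun jet_inv :: "'n::finite jet \<Rightarrow> 'n jet" where
  "jet_inv (x, y, A) = (y, x, matrix_inv A)"

lemma jet_comp_jet:
  assumes "\<phi> differentiable (at x)" "\<psi> differentiable (at (\<phi> x))"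
  shows "jet_comp (jet \<psi> (\<phi> x)) (jet \<phi> x) = jet (\<psi> \<circ> \<phi>) x"
proof -
  have "linear (frechet_derivative \<phi> (at x))" "linear (frechet_derivative \<psi> (at (\<phi> x)))"
    using assms by (simp_all add: linear_frechet_derivative)
  then have "matrix (frechet_derivative \<psi> (at (\<phi> x)) \<circ> frechet_derivative \<phi> (at x)) =
      matrix (frechet_derivative \<psi> (at (\<phi> x))) ** matrix (frechet_derivative \<phi> (at x))"
    by (rule matrix_compose)
  then show ?thesis
    using frechet_derivative_compose[OF assms] by (simp add: jet_def)
qed

definition local_diffeomorphism ::
    "(real ^ 'n::finite) set \<Rightarrow> real ^ 'n \<Rightarrow> (real ^ 'n \<Rightarrow> real ^ 'n) \<Rightarrow> bool" where
  "local_diffeomorphism M x \<phi> \<longleftrightarrow>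
     (\<exists>U V. x \<in> U \<and> U \<subseteq> M \<and> V \<subseteq> M \<and> diffeomorphism U V \<phi>)"

definition jets :: "(real ^ 'n::finite) set \<Rightarrow> 'n jet set" where
  "jets M = {jet \<phi> x | \<phi> x. local_diffeomorphism M x \<phi>}"

lemma jets_iff:
  fixes M :: "(real ^ 'n::finite) set"
  assumes "open M"
  shows "(x, y, A) \<in> jets M \<longleftrightarrow> x \<in> M \<and> y \<in> M \<and> invertible A"
proof
  assume "(x, y, A) \<in> jets M"
  then obtain \<phi> U V \<psi> where *: "x \<in> U" "U \<subseteq> M" "V \<subseteq> M" "open U" "open V"
    "homeomorphism U V \<phi> \<psi>" "smooth_on U \<phi>" "smooth_on V \<psi>"
    "y = \<phi> x" "A = matrix (frechet_derivative \<phi> (at x))"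
    unfolding jets_def local_diffeomorphism_def diffeomorphism_def jet_def by auto
  have yV: "y \<in> V" using * by (auto simp: homeomorphism_def)
  have "Ck_on (Suc 0) U \<phi>" "Ck_on (Suc 0) V \<psi>" using * unfolding smooth_on_def by blast+
  then have d: "\<phi> differentiable (at x)" "\<psi> differentiable (at y)" using * yV by auto
  have "jet_comp (jet \<psi> (\<phi> x)) (jet \<phi> x) = jet (\<psi> \<circ> \<phi>) x"
    using d * by (intro jet_comp_jet) auto
  moreover have "((\<psi> \<circ> \<phi>) has_derivative id) (at x)"
  proof (rule has_derivative_transform_within_open[of id id x UNIV U])
    show "(id has_derivative id) (at x)" by (simp add: id_def)
  qed (use * in \<open>auto simp: homeomorphism_def\<close>)
  then have "frechet_derivative (\<psi> \<circ> \<phi>) (at x) = id"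
    using frechet_derivative_at by metis
  ultimately have "matrix (frechet_derivative \<psi> (at y)) ** A = mat 1"
    using * by (simp add: jet_def matrix_id_mat_1)
  then have "invertible A" using invertible_left_inverse by blast
  then show "x \<in> M \<and> y \<in> M \<and> invertible A" using * yV by auto
next
  assume r: "x \<in> M \<and> y \<in> M \<and> invertible A"
  define \<phi> where "\<phi> = (\<lambda>p. A *v p + (y - A *v x))"
  obtain B where AB: "A ** B = mat 1" "B ** A = mat 1" using r unfolding invertible_def by blast
  define \<psi> where "\<psi> = (\<lambda>q. B *v q + (x - B *v y))"
  have inv: "\<psi> (\<phi> p) = p" "\<phi> (\<psi> p) = p" for p
    by (simp_all add: \<phi>_def \<psi>_def matrix_vector_right_distrib matrix_vector_mult_diff_distrib
        matrix_vector_mul_assoc AB)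
  have sm: "smooth_on S \<phi>" "smooth_on S \<psi>" for S
    unfolding \<phi>_def \<psi>_def by (intro smooth_on_affine matrix_vector_mul_linear)+
  have c: "continuous_on S \<phi>" "continuous_on S \<psi>" for S
    using sm[of S] unfolding smooth_on_def by (metis Ck_on.simps(1))+
  define U where "U = M \<inter> \<phi> -` M"
  define V where "V = M \<inter> \<psi> -` M"
  have "open U" "open V"
    unfolding U_def V_def using assms c by (auto intro!: open_Int open_vimage)
  moreover have "homeomorphism U V \<phi> \<psi>"
  proof (rule homeomorphismI)
    show "\<phi> ` U \<subseteq> V" "\<psi> ` V \<subseteq> U" by (auto simp: U_def V_def inv)
  qed (auto simp: c inv)
  moreover have "x \<in> U" using r by (auto simp: U_def \<phi>_def)
  moreover have "U \<subseteq> M" "V \<subseteq> M" by (auto simp: U_def V_def)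
  ultimately have "local_diffeomorphism M x \<phi>"
    unfolding local_diffeomorphism_def diffeomorphism_def
    by (intro exI[of _ U] exI[of _ V] exI[of _ \<psi>] conjI sm)
  moreover have "(\<phi> has_derivative (*v) A) (at x)"
    unfolding \<phi>_def
    by (rule has_derivative_add_const[OF
          bounded_linear_imp_has_derivative[OF matrix_vector_mul_bounded_linear]])
  then have "frechet_derivative \<phi> (at x) = (*v) A" using frechet_derivative_at by metis
  then have "jet \<phi> x = (x, y, A)" by (simp add: jet_def \<phi>_def)
  ultimately show "(x, y, A) \<in> jets M" unfolding jets_def mem_Collect_eq
    by (intro exI[of _ \<phi>] exI[of _ x]) simp
qed

definition jet_groupoid :: "(real ^ 'n::finite) set \<Rightarrow> ('n jet, real ^ 'n) groupoid_data" where
  "jet_groupoid M =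
     \<lparr>arrows = top_of_set (jets M),
      objects = top_of_set M,
      source = jet_source,
      target = jet_target,
      ident = jet id,
      mult = jet_comp,
      ginv = jet_inv\<rparr>"

section \<open>Simple bodies\<close>

text \<open>
  The body is identified with its reference configuration, an open subset \<open>B\<close> of \<open>real ^ 3\<close>.
  Connectedness is not part of the definition.
\<close>

definition translate_target :: "real ^ 'n \<Rightarrow> 'n::finite jet \<Rightarrow> 'n jet" where
  "translate_target v j = jet_comp (jet (\<lambda>p. p + v) (jet_target j)) j"

definition response_functional ::
    "(real ^ 3) set \<Rightarrow> (3 jet \<Rightarrow> 'v::real_normed_vector) \<Rightarrow> bool" where
  "response_functional B W \<longleftrightarrow>
     W differentiable_on jets B \<and>
     (\<forall>j\<in>jets B. \<forall>Z\<in>B. W j = W (translate_target (Z - jet_target j) j))"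

definition simple_body :: "(real ^ 3) set \<Rightarrow> (3 jet \<Rightarrow> 'v::real_normed_vector) \<Rightarrow> bool" where
  "simple_body B W \<longleftrightarrow> open B \<and> response_functional B W"

text \<open>
  The extension of \<open>W\<close> to jets from points of the body to arbitrary points of \<open>real ^ 3\<close>: the target is
  translated to a point of the body. By invariance of \<open>W\<close> every such point gives the same value; we
  use the source of the jet.
\<close>

definition extended_response :: "(3 jet \<Rightarrow> 'v) \<Rightarrow> 3 jet \<Rightarrow> 'v" where
  "extended_response W j = W (translate_target (jet_source j - jet_target j) j)"

definition deformation :: "(real ^ 3) set \<Rightarrow> (real ^ 3 \<Rightarrow> real ^ 3) \<Rightarrow> bool" where
  "deformation B \<kappa> \<longleftrightarrow>
     smooth_on B \<kappa> \<and> (\<forall>x\<in>B. inj (frechet_derivative \<kappa> (at x))) \<and>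
     (\<exists>\<psi>. homeomorphism B (\<kappa> ` B) \<kappa> \<psi>)"

definition material_isomorphisms :: "(real ^ 3) set \<Rightarrow> (3 jet \<Rightarrow> 'v) \<Rightarrow> 3 jet set" where
  "material_isomorphisms B W =
     {g \<in> jets B. \<forall>\<kappa>. deformation B \<kappa> \<longrightarrow>
        extended_response W (jet_comp (jet \<kappa> (jet_target g)) g) =
        extended_response W (jet \<kappa> (jet_target g))}"

definition uniform_body :: "(real ^ 3) set \<Rightarrow> (3 jet \<Rightarrow> 'v) \<Rightarrow> bool" where
  "uniform_body B W \<longleftrightarrow>
     (\<forall>X\<in>B. \<forall>Y\<in>B. \<exists>g\<in>material_isomorphisms B W. jet_source g = X \<and> jet_target g = Y)"

text \<open>
  The groupoid over \<open>B\<close> of the jets in \<open>topspace T\<close>, where \<open>T\<close> is the topology of a manifold structure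
  on the set of material isomorphisms.
\<close>

definition material_groupoid :: "(real ^ 3) set \<Rightarrow> 3 jet topology \<Rightarrow> (3 jet, real ^ 3) groupoid_data" where
  "material_groupoid B T = (jet_groupoid B)\<lparr>arrows := T\<rparr>"

end

theory Submission
  imports Defs
begin

text \<open>
  The source and target maps of the material groupoid \<open>\<Omega>\<close> form the map \<open>(\<alpha>, \<beta>) : \<Omega> \<rightarrow> B \<times> B\<close>; let \<open>R\<^sub>g\<close>
  be the image of its differential at \<open>g\<close>. As \<open>\<beta>\<close> is a submersion, the anchor at \<open>x\<close> is onto iff
  \<open>R\<close> is everything at the identity of \<open>x\<close>.

  If this holds for all \<open>x\<close>, then \<open>(\<alpha>, \<beta>)\<close> is open at the identities, so the orbits are open, and as \<open>B\<close>
  is connected there is only one. Conversely, left multiplication shows that the vectors \<open>(0, w)\<close> in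
  \<open>R\<^sub>g\<close>, and hence the dimension of \<open>R\<^sub>g\<close>, depend on \<open>\<beta>(g)\<close> only; symmetrically the dimension depends on
  \<open>\<alpha>(g)\<close> only. On a uniform body \<open>(\<alpha>, \<beta>)\<close> therefore has constant rank. If the rank were less than
  \<open>dim (B \<times> B)\<close>, its image, which is all of \<open>B \<times> B\<close>, would be a null set because \<open>\<Omega>\<close> is second
  countable.
\<close>

subsection \<open>Tangent spaces of submanifolds\<close>

text \<open>The derivatives in \<open>Ck_on\<close> are taken in the ambient space, so equality of
  two functions on \<open>S\<close> passes to their derivatives because \<open>S\<close> is
  open.\<close>

lemma Ck_on_cong:
  assumes "open S" "\<And>x. x \<in> S \<Longrightarrow> f x = g x" "Ck_on k S f"
  shows "Ck_on k S g"
  using assms(2,3)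
proof (induction k arbitrary: f g)
  case 0
  then show ?case using continuous_on_cong by fastforce
next
  case (Suc k)
  have hd: "(g has_derivative frechet_derivative f (at x)) (at x)" if "x \<in> S" for x
    using Suc.prems that assms(1)
    by (intro has_derivative_transform_within_open[of f "frechet_derivative f (at x)" x UNIV S g])
      (auto simp: frechet_derivative_works)
  then have fd: "frechet_derivative f (at x) v = frechet_derivative g (at x) v" if "x \<in> S" for x v
    using frechet_derivative_at that by metis
  have "Ck_on k S (\<lambda>x. frechet_derivative g (at x) v)" for v
    by (rule Suc.IH[OF fd]) (use Suc.prems in auto)
  then show ?case using hd by (auto simp: differentiable_def)
qed

text \<open>A directional derivative of \<open>f\<close>, restricted to the line, is the derivative
  of the restriction, so the induction runs over \<open>f\<close>. The lemma provides the smooth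
  curves that realise tangent vectors of a parametrized submanifold.\<close>

lemma Ck_on_along_line:
  fixes f :: "'a::euclidean_space \<Rightarrow> 'b::real_normed_vector"
  assumes "open I" "\<And>t. t \<in> I \<Longrightarrow> a + t *\<^sub>R l \<in> S" "Ck_on k S f"
  shows "Ck_on k I (\<lambda>t::real. f (a + t *\<^sub>R l))"
  using assms(3)
proof (induction k arbitrary: f)
  case 0
  then show ?case
    using assms(2) by (auto intro!: continuous_on_compose2[of S f] continuous_intros)
next
  case (Suc k)
  have hd: "((\<lambda>t. f (a + t *\<^sub>R l)) has_derivative (\<lambda>s. frechet_derivative f (at (a + t *\<^sub>R l)) (s *\<^sub>R l))) (at t)"
    if "t \<in> I" for t
  proof (rule has_derivative_compose[where f="\<lambda>t. a + t *\<^sub>R l"])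
    show "((\<lambda>t. a + t *\<^sub>R l) has_derivative (\<lambda>s. s *\<^sub>R l)) (at t)"
      by (auto intro!: derivative_eq_intros)
    show "(f has_derivative frechet_derivative f (at (a + t *\<^sub>R l))) (at (a + t *\<^sub>R l))"
      using Suc.prems assms(2) that by (auto simp: frechet_derivative_works)
  qed
  have "Ck_on k I (\<lambda>t. frechet_derivative (\<lambda>t. f (a + t *\<^sub>R l)) (at t) s)" for s
  proof (rule Ck_on_cong[OF assms(1)])
    show "Ck_on k I (\<lambda>t. frechet_derivative f (at (a + t *\<^sub>R l)) (s *\<^sub>R l))"
      using Suc.prems by (intro Suc.IH) auto
    show "frechet_derivative f (at (a + t *\<^sub>R l)) (s *\<^sub>R l) =
        frechet_derivative (\<lambda>t. f (a + t *\<^sub>R l)) (at t) s" if "t \<in> I" for t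
      using frechet_derivative_at[OF hd[OF that]] by metis
  qed
  then show ?case using hd by (auto simp: differentiable_def)
qed

text \<open>In finite dimension a family of linear maps is continuous as soon as its values at each
  fixed vector are. The bundled derivative \<open>f'\<close> is the form that the inverse function
  theorem takes.\<close>

lemma smooth_on_imp_C1:
  fixes f :: "'a::euclidean_space \<Rightarrow> 'b::real_normed_vector"
  assumes "smooth_on S f"
  obtains f' :: "'a \<Rightarrow> 'a \<Rightarrow>\<^sub>L 'b"
  where "\<forall>x\<in>S. (f has_derivative blinfun_apply (f' x)) (at x)" "continuous_on S f'"
proof
  define f' where "f' x = Blinfun (frechet_derivative f (at x))" for x
  have "Ck_on (Suc 0) S f" using assms unfolding smooth_on_def by blast
  then have d: "\<And>x. x \<in> S \<Longrightarrow> f differentiable (at x)"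
    and c: "\<And>v. continuous_on S (\<lambda>x. frechet_derivative f (at x) v)" by auto
  have app: "blinfun_apply (f' x) = frechet_derivative f (at x)" if "x \<in> S" for x
    unfolding f'_def using d[OF that]
    by (intro bounded_linear_Blinfun_apply has_derivative_bounded_linear[of f])
      (simp add: frechet_derivative_works)
  then show "\<forall>x\<in>S. (f has_derivative blinfun_apply (f' x)) (at x)"
    using d by (simp add: frechet_derivative_works)
  show "continuous_on S f'"
  proof (rule continuous_on_blinfun_componentwise)
    show "continuous_on S (\<lambda>x. blinfun_apply (f' x) i)" for i
      using c[of i] by (rule continuous_on_eq) (simp add: app)
  qed
qed

text \<open>
  On a submanifold, differentiability at \<open>0\<close> already puts the velocity of such a curve in the tangent
  space, so curves built from local inverses or products need not be shown to be smooth.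
\<close>

definition weak_tangent_curve ::
    "'a::euclidean_space topology \<Rightarrow> 'a \<Rightarrow> 'a \<Rightarrow> (real \<Rightarrow> 'a) \<Rightarrow> bool" where
  "weak_tangent_curve T p v \<gamma> \<longleftrightarrow>
     (\<exists>e>0. continuous_map (top_of_set {-e<..<e}) T \<gamma>) \<and>
     \<gamma> 0 = p \<and> (\<gamma> has_vector_derivative v) (at 0)"

lemma tangent_curve_imp_weak: "tangent_curve T p v \<gamma> \<Longrightarrow> weak_tangent_curve T p v \<gamma>"
  unfolding tangent_curve_def weak_tangent_curve_def by blast

text \<open>\<open>T\<close> may be finer than the ambient topology, so it is the continuity of the
  curve into \<open>T\<close> that keeps it in \<open>U\<close> for a short time.\<close>

lemma weak_tangent_curve_eventually:
  assumes "weak_tangent_curve T p v \<gamma>" "openin T U" "p \<in> U"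
  obtains e where "e > 0" "continuous_map (top_of_set {-e<..<e}) T \<gamma>" "\<gamma> ` {-e<..<e} \<subseteq> U"
proof -
  obtain e where e: "e > 0" "continuous_map (top_of_set {-e<..<e}) T \<gamma>"
    and g: "\<gamma> 0 = p" using assms(1) unfolding weak_tangent_curve_def by blast
  have "openin (top_of_set {-e<..<e}) {t \<in> {-e<..<e}. \<gamma> t \<in> U}"
    using openin_continuous_map_preimage[OF e(2) assms(2)] by (simp add: Collect_conj_eq)
  then have "open {t \<in> {-e<..<e}. \<gamma> t \<in> U}"
    by (rule openin_open_trans) simp
  moreover have "0 \<in> {t \<in> {-e<..<e}. \<gamma> t \<in> U}" using e g assms(3) by auto
  ultimately obtain d where d: "d > 0" "ball 0 d \<subseteq> {t \<in> {-e<..<e}. \<gamma> t \<in> U}"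
    by (meson open_contains_ball_eq)
  have b: "ball (0::real) d = {-d<..<d}" by (auto simp: dist_real_def)
  show ?thesis
  proof
    show "continuous_map (top_of_set {-d<..<d}) T \<gamma>"
      using e(2) d(2) b by (intro continuous_map_from_subtopology_mono[OF e(2)]) auto
  qed (use d b in auto)
qed

text \<open>The velocity is the limit of difference quotients, which lie in \<open>L\<close>, and a
  subspace of a Euclidean space is closed.\<close>

lemma has_vector_derivative_in_subspace:
  fixes \<gamma> :: "real \<Rightarrow> 'a::euclidean_space"
  assumes "subspace L" "(\<gamma> has_vector_derivative v) (at 0)" "e > 0"
    "\<And>t. t \<in> {-e<..<e} \<Longrightarrow> \<gamma> t \<in> L"
  shows "v \<in> L"
proof (rule Lim_in_closed_set[of L "\<lambda>t. (1/t) *\<^sub>R (\<gamma> t - \<gamma> 0)" "at 0"])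
  show "closed L" using assms(1) by (rule closed_subspace)
  have "\<forall>\<^sub>F t in at (0::real). t \<in> {-e<..<e}"
    using assms(3) by (intro eventually_at_in_open') auto
  then show "\<forall>\<^sub>F t in at 0. (1/t) *\<^sub>R (\<gamma> t - \<gamma> 0) \<in> L"
    by eventually_elim (use assms in \<open>auto intro!: subspace_scale subspace_diff\<close>)
  have "((\<lambda>t. (1/norm (t - 0)) *\<^sub>R (\<gamma> t - (\<gamma> 0 + (t - 0) *\<^sub>R v))) \<longlongrightarrow> 0) (at 0)"
    using assms(2) unfolding has_vector_derivative_def has_derivative_within by simp
  then have "((\<lambda>t. norm ((1/norm (t - 0)) *\<^sub>R (\<gamma> t - (\<gamma> 0 + (t - 0) *\<^sub>R v)))) \<longlongrightarrow> 0) (at 0)"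
    by (rule tendsto_norm_zero)
  \<comment> \<open>The quotients by \<open>norm t\<close> and by \<open>t\<close> differ only in
    sign, so they have the same norm.\<close>
  moreover have "\<forall>\<^sub>F t in at 0. norm ((1/norm (t - 0)) *\<^sub>R (\<gamma> t - (\<gamma> 0 + (t - 0) *\<^sub>R v)))
      = norm ((1/t) *\<^sub>R (\<gamma> t - \<gamma> 0) - v)"
    unfolding eventually_at_topological
  proof (intro exI[of _ UNIV] conjI ballI impI)
    fix t :: real assume "t \<noteq> 0"
    then have "(1/t) *\<^sub>R (\<gamma> t - \<gamma> 0) - v = (1/t) *\<^sub>R (\<gamma> t - (\<gamma> 0 + (t - 0) *\<^sub>R v))"
      by (simp add: algebra_simps)
    then show "norm ((1/norm (t - 0)) *\<^sub>R (\<gamma> t - (\<gamma> 0 + (t - 0) *\<^sub>R v)))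
      = norm ((1/t) *\<^sub>R (\<gamma> t - \<gamma> 0) - v)" by simp
  qed auto
  ultimately have "((\<lambda>t. norm ((1/t) *\<^sub>R (\<gamma> t - \<gamma> 0) - v)) \<longlongrightarrow> 0) (at 0)"
    using tendsto_cong by fast
  then show "((\<lambda>t. (1/t) *\<^sub>R (\<gamma> t - \<gamma> 0)) \<longlongrightarrow> v) (at 0)"
    using LIM_zero_iff tendsto_norm_zero_iff by blast
qed auto

lemma has_vector_derivative_compose_has_derivative:
  assumes "(\<gamma> has_vector_derivative v) (at t)" "(f has_derivative f') (at (\<gamma> t))"
  shows "((\<lambda>t. f (\<gamma> t)) has_vector_derivative f' v) (at t)"
proof -
  interpret f': bounded_linear f' using assms(2) by (rule has_derivative_bounded_linear)
  show ?thesis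
    using has_derivative_compose[OF assms(1)[unfolded has_vector_derivative_def] assms(2)]
    by (simp add: has_vector_derivative_def f'.scaleR)
qed

section \<open>Local parametrizations of a submanifold\<close>

text \<open>The local parametrization is the restriction of \<open>\<psi>\<close> to
  \<open>V \<inter> L\<close>. Keeping \<open>\<psi>\<close> on the open set \<open>V\<close> of the
  ambient space makes its derivative an ordinary one; openness and continuity refer to the topology
  \<open>T\<close>.\<close>

definition parametrization ::
    "'a::euclidean_space topology \<Rightarrow> 'a set \<Rightarrow> 'a set \<Rightarrow> ('a \<Rightarrow> 'a) \<Rightarrow> ('a \<Rightarrow> 'a \<Rightarrow>\<^sub>L 'a) \<Rightarrow> bool" where
  "parametrization T V L \<psi> \<psi>' \<longleftrightarrow>
     open V \<and> subspace L \<and>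
     (\<forall>x\<in>V. (\<psi> has_derivative blinfun_apply (\<psi>' x)) (at x)) \<and> continuous_on V \<psi>' \<and>
     (\<forall>W. open W \<longrightarrow> W \<subseteq> V \<longrightarrow> openin T (\<psi> ` (W \<inter> L))) \<and> continuous_map (top_of_set (V \<inter> L)) T \<psi> \<and>
     (\<forall>x\<in>V \<inter> L. tangent_space T (\<psi> x) = blinfun_apply (\<psi>' x) ` L)"

text \<open>The inverse of a slice chart is a parametrization. Velocities of curves are computed in
  the chart, where the submanifold is a piece of \<open>L\<close>; this works for weak tangent
  curves as well, which gives the last conclusion.\<close>

lemma submanifold_parametrization:
  fixes T :: "'a::euclidean_space topology"
  assumes "submanifold k T" "p \<in> topspace T"
  obtains V L \<psi> \<psi>' z where "parametrization T V L \<psi> \<psi>'" "z \<in> V \<inter> L" "\<psi> z = p"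
    "\<And>v \<gamma>. weak_tangent_curve T p v \<gamma> \<Longrightarrow> v \<in> tangent_space T p"
proof -
  obtain U where U: "openin T U" "p \<in> U" "embedded_submanifold k U" "subtopology T U = top_of_set U"
    using assms unfolding submanifold_def by blast
  obtain U1 V L and \<phi> :: "'a \<Rightarrow> 'a" where 1: "p \<in> U1" "diffeomorphism U1 V \<phi>" "subspace L"
    "\<phi> ` (U1 \<inter> U) = V \<inter> L"
    using bspec[OF U(3)[unfolded embedded_submanifold_def] U(2)] by (elim exE conjE)
  then obtain \<psi> where 2: "open U1" "open V" "homeomorphism U1 V \<phi> \<psi>" "smooth_on U1 \<phi>" "smooth_on V \<psi>"
    unfolding diffeomorphism_def by blast
  obtain \<psi>' where \<psi>': "\<forall>x\<in>V. (\<psi> has_derivative blinfun_apply (\<psi>' x)) (at x)"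
    "continuous_on V \<psi>'" by (rule smooth_on_imp_C1[OF 2(5)])
  obtain \<phi>' where \<phi>': "\<forall>x\<in>U1. (\<phi> has_derivative blinfun_apply (\<phi>' x)) (at x)"
    "continuous_on U1 \<phi>'" by (rule smooth_on_imp_C1[OF 2(4)])
  have inv: "\<And>x. x \<in> U1 \<Longrightarrow> \<phi> x \<in> V \<and> \<psi> (\<phi> x) = x" "\<And>x. x \<in> V \<Longrightarrow> \<psi> x \<in> U1 \<and> \<phi> (\<psi> x) = x"
    using 2(3) by (auto simp: homeomorphism_def)
  have im: "\<psi> ` (V \<inter> L) = U1 \<inter> U"
    unfolding 1(4)[symmetric] image_image using inv by auto
  \<comment> \<open>\<open>U\<close> is open in \<open>T\<close>, and on \<open>U\<close> the
    topology \<open>T\<close> is the ambient one.\<close>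
  have open_U: "openin T (W \<inter> U)" if "open W" for W
  proof -
    have "openin (subtopology T U) (W \<inter> U)"
      unfolding U(4) using that by (metis inf_commute openin_open_Int)
    then show ?thesis using U(1) by (rule openin_trans_full)
  qed
  have op: "openin T (U1 \<inter> U)" using 2(1) by (rule open_U)
  have op_im: "openin T (\<psi> ` (W \<inter> L))" if W: "open W" "W \<subseteq> V" for W
  proof -
    have "\<psi> ` (W \<inter> L) = (U1 \<inter> \<phi> -` W) \<inter> U"
    proof
      show "\<psi> ` (W \<inter> L) \<subseteq> (U1 \<inter> \<phi> -` W) \<inter> U" using W(2) im inv(2) by auto
      show "(U1 \<inter> \<phi> -` W) \<inter> U \<subseteq> \<psi> ` (W \<inter> L)"
      proof
        fix x assume x: "x \<in> (U1 \<inter> \<phi> -` W) \<inter> U"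
        then have "\<phi> x \<in> W \<inter> L" "\<psi> (\<phi> x) = x" using 1(4) inv(1) by auto
        then show "x \<in> \<psi> ` (W \<inter> L)" by (metis imageI)
      qed
    qed
    moreover have "open (U1 \<inter> \<phi> -` W)"
      using 2(1,3) W(1) by (intro continuous_open_preimage) (auto simp: homeomorphism_def)
    ultimately show ?thesis using open_U by simp
  qed
  have cont: "continuous_map (top_of_set (V \<inter> L)) T \<psi>"
  proof -
    have "continuous_on V \<psi>" using 2(3) by (simp add: homeomorphism_def)
    then have "continuous_on (V \<inter> L) \<psi>" by (rule continuous_on_subset) auto
    then have "continuous_map (top_of_set (V \<inter> L)) (subtopology T U) \<psi>"
      unfolding U(4) using im by auto
    then show ?thesis by (simp add: continuous_map_in_subtopology)
  qed
  \<comment> \<open>In the chart the curve runs in \<open>L\<close>, hence so does its velocity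
    \<open>l\<close>; applying \<open>\<psi>\<close> again recovers \<open>v\<close> as the image of
    \<open>l\<close>.\<close>
  have curve: "v \<in> blinfun_apply (\<psi>' x) ` L"
    if x: "x \<in> V" "x \<in> L" and c: "weak_tangent_curve T (\<psi> x) v \<gamma>" for x v \<gamma>
  proof -
    have px: "\<psi> x \<in> U1 \<inter> U" using im x by blast
    obtain e where e: "e > 0" "\<gamma> ` {-e<..<e} \<subseteq> U1 \<inter> U"
      by (rule weak_tangent_curve_eventually[OF c op px])
    have g: "\<gamma> 0 = \<psi> x" "(\<gamma> has_vector_derivative v) (at 0)"
      using c unfolding weak_tangent_curve_def by auto
    define l where "l = blinfun_apply (\<phi>' (\<psi> x)) v"
    have d1: "((\<phi> \<circ> \<gamma>) has_vector_derivative l) (at 0)"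
      unfolding l_def o_def
      by (rule has_vector_derivative_compose_has_derivative[OF g(2)]) (use \<phi>' px g(1) in simp)
    have "l \<in> L"
    proof (rule has_vector_derivative_in_subspace[OF 1(3) d1 e(1)])
      show "(\<phi> \<circ> \<gamma>) t \<in> L" if "t \<in> {-e<..<e}" for t using e(2) that 1(4) by fastforce
    qed
    have "((\<lambda>t. \<psi> ((\<phi> \<circ> \<gamma>) t)) has_vector_derivative blinfun_apply (\<psi>' x) l) (at 0)"
      by (rule has_vector_derivative_compose_has_derivative[OF d1]) (use \<psi>' x g(1) inv in simp)
    then have "(\<gamma> has_vector_derivative blinfun_apply (\<psi>' x) l) (at 0)"
    proof (rule has_vector_derivative_transform_within_open)
      show "0 \<in> {-e<..<e}" using e by auto
      show "\<psi> ((\<phi> \<circ> \<gamma>) t) = \<gamma> t" if "t \<in> {-e<..<e}" for t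
        using e(2) that inv(1)[of "\<gamma> t"] by (simp add: image_subset_iff)
    qed auto
    then have "v = blinfun_apply (\<psi>' x) l" using g(2) vector_derivative_unique_at by blast
    then show ?thesis using \<open>l \<in> L\<close> by blast
  qed
  \<comment> \<open>Conversely \<open>l\<close> is the velocity of a straight line in
    \<open>V \<inter> L\<close>, and \<open>\<psi>\<close> maps this line to a smooth curve.\<close>
  have line: "blinfun_apply (\<psi>' x) l \<in> tangent_space T (\<psi> x)"
    if x: "x \<in> V" "x \<in> L" "l \<in> L" for x l
  proof -
    have "open ((\<lambda>t::real. x + t *\<^sub>R l) -` V)"
      using 2(2) by (intro open_vimage continuous_intros)
    moreover have "0 \<in> (\<lambda>t::real. x + t *\<^sub>R l) -` V" using x by simp
    ultimately obtain e where e: "e > 0" "ball (0::real) e \<subseteq> (\<lambda>t::real. x + t *\<^sub>R l) -` V"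
      by (rule openE)
    have b: "ball (0::real) e = {-e<..<e}" by (auto simp: dist_real_def)
    have sub: "x + t *\<^sub>R l \<in> V \<inter> L" if "t \<in> {-e<..<e}" for t
    proof
      show "x + t *\<^sub>R l \<in> V" using e(2) b that by auto
      show "x + t *\<^sub>R l \<in> L" using x 1(3) by (intro subspace_add subspace_scale)
    qed
    have "tangent_curve T (\<psi> x) (blinfun_apply (\<psi>' x) l) (\<lambda>t. \<psi> (x + t *\<^sub>R l))"
      unfolding tangent_curve_def
    proof (intro conjI exI[of _ e] e)
      show "continuous_map (top_of_set {-e<..<e}) T (\<lambda>t. \<psi> (x + t *\<^sub>R l))"
      proof (rule continuous_map_compose[OF _ cont, of _ "\<lambda>t. x + t *\<^sub>R l", unfolded o_def])
        show "continuous_map (top_of_set {-e<..<e}) (top_of_set (V \<inter> L)) (\<lambda>t. x + t *\<^sub>R l)"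
          using sub by (auto intro!: continuous_intros)
      qed
      show "smooth_on {-e<..<e} (\<lambda>t. \<psi> (x + t *\<^sub>R l))"
        using 2(5) sub unfolding smooth_on_def by (auto intro!: Ck_on_along_line[of _ _ _ V])
      show "((\<lambda>t. \<psi> (x + t *\<^sub>R l)) has_vector_derivative blinfun_apply (\<psi>' x) l) (at 0)"
        by (rule has_vector_derivative_compose_has_derivative)
          (use \<psi>' x in \<open>auto intro!: derivative_eq_intros\<close>)
    qed simp
    then show ?thesis unfolding tangent_space_def by blast
  qed
  have tan: "tangent_space T (\<psi> x) = blinfun_apply (\<psi>' x) ` L" if "x \<in> V \<inter> L" for x
    using line[of x] curve[of x] tangent_curve_imp_weak that unfolding tangent_space_def by blast
  show ?thesis
  proof (rule that[of V L \<psi> \<psi>' "\<phi> p"])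
    show "parametrization T V L \<psi> \<psi>'"
      unfolding parametrization_def using 1(3) 2(2) \<psi>' op_im cont tan by simp
    show z: "\<phi> p \<in> V \<inter> L" and psi: "\<psi> (\<phi> p) = p" using 1 U(2) inv by auto
    show "v \<in> tangent_space T p" if "weak_tangent_curve T p v \<gamma>" for v \<gamma>
      using curve[of "\<phi> p" v \<gamma>] tan[OF z] psi z that by simp
  qed
qed

lemma tangent_space_iff_weak_tangent_curve:
  assumes "submanifold k T" "p \<in> topspace T"
  shows "v \<in> tangent_space T p \<longleftrightarrow> (\<exists>\<gamma>. weak_tangent_curve T p v \<gamma>)"
proof
  show "\<exists>\<gamma>. weak_tangent_curve T p v \<gamma>" if "v \<in> tangent_space T p"
    using that tangent_curve_imp_weak unfolding tangent_space_def by blast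
  show "v \<in> tangent_space T p" if "\<exists>\<gamma>. weak_tangent_curve T p v \<gamma>"
    by (rule submanifold_parametrization[OF assms]) (use that in blast)
qed

lemma subspace_tangent_space:
  assumes "submanifold k T" "p \<in> topspace T"
  shows "subspace (tangent_space T p)"
proof (rule submanifold_parametrization[OF assms])
  fix V L \<psi> \<psi>' z assume *: "parametrization T V L \<psi> \<psi>'" "z \<in> V \<inter> L" "\<psi> z = p"
  then have "tangent_space T p = blinfun_apply (\<psi>' z) ` L" "subspace L"
    unfolding parametrization_def by auto
  then show ?thesis
    by (simp add: linear_subspace_image blinfun.bounded_linear_right bounded_linear.linear)
qed

subsection \<open>Submersions and maps of constant rank\<close>

text \<open>Take a linear section \<open>M\<close> of the differential of
  \<open>a \<circ> \<psi>\<close>, with values in \<open>L\<close>. The map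
  \<open>y \<mapsto> a (\<psi> (z + M y))\<close> is then invertible near \<open>0\<close>, with
  inverse \<open>\<tau>\<close>, and \<open>\<sigma> y = \<psi> (z + M (\<tau> y))\<close>.\<close>

lemma submersion_local_section:
  fixes T :: "'a::euclidean_space topology" and a :: "'a \<Rightarrow> 'b::euclidean_space"
  assumes "submanifold k T" "p \<in> topspace T" "linear a" "a ` tangent_space T p = UNIV"
  obtains N \<sigma> \<sigma>' where "open N" "a p \<in> N" "\<sigma> (a p) = p" "continuous_map (top_of_set N) T \<sigma>"
    "(\<sigma> has_derivative \<sigma>') (at (a p))" "\<forall>y\<in>N. a (\<sigma> y) = y"
proof -
  obtain V L \<psi> \<psi>' z where par: "parametrization T V L \<psi> \<psi>'" and z: "z \<in> V \<inter> L" "\<psi> z = p"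
    by (rule submanifold_parametrization[OF assms(1,2)])
  then have V: "open V" "subspace L" "z \<in> V" "z \<in> L" "\<psi> z = p"
    and d: "\<And>x. x \<in> V \<Longrightarrow> (\<psi> has_derivative blinfun_apply (\<psi>' x)) (at x)"
    and cd: "continuous_on V \<psi>'"
    and cont: "continuous_map (top_of_set (V \<inter> L)) T \<psi>"
    and tan: "\<And>x. x \<in> V \<inter> L \<Longrightarrow> tangent_space T (\<psi> x) = blinfun_apply (\<psi>' x) ` L"
    unfolding parametrization_def by auto
  have bl: "bounded_linear a" using assms(3) by (simp add: linear_conv_bounded_linear)
  have "linear (\<lambda>v. a (blinfun_apply (\<psi>' z) v))"
    using linear_compose[OF _ assms(3), of "blinfun_apply (\<psi>' z)"]
    by (simp add: o_def blinfun.bounded_linear_right bounded_linear.linear)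
  then obtain M where M: "range M \<subseteq> L" "linear M"
    "\<forall>v\<in>(\<lambda>v. a (blinfun_apply (\<psi>' z) v)) ` L. a (blinfun_apply (\<psi>' z) (M v)) = v"
    using linear_exists_right_inverse_on[OF _ V(2)] by blast
  have "tangent_space T p = blinfun_apply (\<psi>' z) ` L" using tan z by metis
  then have "(\<lambda>v. a (blinfun_apply (\<psi>' z) v)) ` L = UNIV" using assms(4) by (simp add: image_image)
  then have M3: "a (blinfun_apply (\<psi>' z) (M v)) = v" for v using M(3) by blast
  have M0: "M 0 = 0" using M(2) by (simp add: linear_0)
  have blM: "bounded_linear M" using M(2) by (simp add: linear_conv_bounded_linear)
  have contM: "continuous_on S M" for S by (rule linear_continuous_on[OF blM])
  define N0 where "N0 = (\<lambda>y. z + M y) -` V"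
  have N0: "open N0" "0 \<in> N0" unfolding N0_def using V M0
    by (auto intro!: open_vimage continuous_intros contM)
  have sub: "z + M y \<in> V \<inter> L" if "y \<in> N0" for y
    using that M(1) V unfolding N0_def by (auto intro!: subspace_add)
  define \<Phi> where "\<Phi> y = a (\<psi> (z + M y))" for y
  define \<Phi>' where "\<Phi>' y = Blinfun a o\<^sub>L \<psi>' (z + M y) o\<^sub>L Blinfun M" for y
  have dz: "((\<lambda>y. z + M y) has_derivative M) (at y)" for y
    using bounded_linear_imp_has_derivative[OF blM] by (auto intro!: derivative_eq_intros)
  have dpsi: "((\<lambda>y. \<psi> (z + M y)) has_derivative (\<lambda>v. blinfun_apply (\<psi>' (z + M y)) (M v))) (at y)"
    if "y \<in> N0" for y
    using sub[OF that] by (intro has_derivative_compose[OF dz] d) simp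
  have 1: "(\<Phi> has_derivative blinfun_apply (\<Phi>' y)) (at y)" if "y \<in> N0" for y
    using bounded_linear.has_derivative[OF bl dpsi[OF that]]
    by (simp add: \<Phi>'_def \<Phi>_def[abs_def] bounded_linear_Blinfun_apply bl blM o_def
        blinfun_apply_blinfun_compose[abs_def])
  have 2: "continuous_on N0 \<Phi>'"
  proof -
    have "continuous_on N0 (\<lambda>y. \<psi>' (z + M y))"
      using sub by (intro continuous_on_compose2[OF cd] continuous_intros contM) auto
    then show ?thesis unfolding \<Phi>'_def by (intro continuous_intros)
  qed
  \<comment> \<open>\<open>M\<close> is chosen so that the derivative of \<open>\<Phi>\<close> at
    \<open>0\<close> is the identity, which is its own inverse.\<close>
  have 3: "id_blinfun o\<^sub>L \<Phi>' 0 = id_blinfun"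
    by (rule blinfun_eqI) (simp add: \<Phi>'_def M0 bounded_linear_Blinfun_apply bl blM M3)
  obtain U' V' \<tau> \<tau>' where U': "open U'" "U' \<subseteq> N0" "0 \<in> U'" "open V'" "\<Phi> 0 \<in> V'"
    "homeomorphism U' V' \<Phi> \<tau>" "\<And>y. y \<in> V' \<Longrightarrow> (\<tau> has_derivative (\<tau>' y)) (at y)"
    "\<And>y. y \<in> V' \<Longrightarrow> \<tau>' y = inv (blinfun_apply (\<Phi>' (\<tau> y)))"
    "\<And>y. y \<in> V' \<Longrightarrow> bij (blinfun_apply (\<Phi>' (\<tau> y)))"
    by (rule inverse_function_theorem[OF N0(1) 1 2 N0(2) 3]) (assumption, (rule that; (assumption | simp)))
  have ap: "\<Phi> 0 = a p" using V M0 by (simp add: \<Phi>_def)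
  have \<tau>: "\<And>y. y \<in> V' \<Longrightarrow> \<tau> y \<in> U' \<and> \<Phi> (\<tau> y) = y" "\<tau> (a p) = 0"
    using U' ap by (auto simp: homeomorphism_def)
  show ?thesis
  proof
    show "open V'" "a p \<in> V'" using U' ap by auto
    show "\<psi> (z + M (\<tau> (a p))) = p" using \<tau> M0 V by simp
    show "continuous_map (top_of_set V') T (\<lambda>y. \<psi> (z + M (\<tau> y)))"
    proof (rule continuous_map_compose[OF _ cont, of _ "\<lambda>y. z + M (\<tau> y)", unfolded o_def])
      have "continuous_on V' \<tau>" using U' by (simp add: homeomorphism_def)
      then have "continuous_on V' (\<lambda>y. z + M (\<tau> y))"
        by (intro continuous_intros continuous_on_compose2[OF contM[of UNIV]]) auto
      moreover have "z + M (\<tau> y) \<in> V \<inter> L" if "y \<in> V'" for y using \<tau>(1)[OF that] U'(2) sub by blast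
      ultimately show "continuous_map (top_of_set V') (top_of_set (V \<inter> L)) (\<lambda>y. z + M (\<tau> y))"
        by auto
    qed
    show "((\<lambda>y. \<psi> (z + M (\<tau> y))) has_derivative
        (\<lambda>v. blinfun_apply (\<psi>' (z + M (\<tau> (a p)))) (M (\<tau>' (a p) v)))) (at (a p))"
      by (rule has_derivative_compose[OF U'(7) dpsi]) (use U' ap \<tau>(2) in auto)
    show "\<forall>y\<in>V'. a (\<psi> (z + M (\<tau> y))) = y"
      using \<tau>(1) by (simp add: \<Phi>_def)
  qed
qed

section \<open>Images of maps of constant rank\<close>

lemma linear_inj_on_subspace_if_dim_image:
  fixes f :: "'a::euclidean_space \<Rightarrow> 'b::euclidean_space"
  assumes "linear f" "subspace A" "dim (f ` A) = dim A"
  shows "inj_on f A"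
proof -
  obtain g where g: "range g \<subseteq> A" "linear g" "\<forall>v\<in>f ` A. f (g v) = v"
    using linear_exists_right_inverse_on[OF assms(1,2)] by blast
  have sub: "subspace (f ` A)" using assms by (simp add: linear_subspace_image)
  have "inj_on g (f ` A)" using g(3) by (metis inj_onI)
  then have "dim (g ` f ` A) = dim (f ` A)"
    using dim_image_eq[OF g(2)] sub by (metis span_eq_iff)
  then have "g ` f ` A = A"
    using g sub assms by (intro subspace_dim_equal) (auto intro: linear_subspace_image)
  then show ?thesis using g(3) by (metis (no_types, lifting) image_iff inj_onI)
qed

text \<open>
  With \<open>S\<close> a generalised inverse of \<open>D = f'(p)\<close>, the map \<open>\<Phi>(x) = x - S (D x) + S (f x)\<close> is a local
  diffeomorphism at \<open>p\<close>, and in the coordinates \<open>\<Phi>\<close> the map \<open>f\<close> is constant along \<open>ker D\<close>; so its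
  image is that of a piece of the proper subspace \<open>range D\<close>.
\<close>

lemma constant_rank_locally_negligible_image:
  fixes f :: "'a::euclidean_space \<Rightarrow> 'b::euclidean_space" and f' :: "'a \<Rightarrow> 'a \<Rightarrow>\<^sub>L 'b"
  assumes "open U" "p \<in> U"
    and d: "\<And>x. x \<in> U \<Longrightarrow> (f has_derivative blinfun_apply (f' x)) (at x)"
    and cd: "continuous_on U f'"
    and rank: "\<And>x. x \<in> U \<Longrightarrow> dim (range (blinfun_apply (f' x))) = r" and "r < DIM('b)"
  obtains N where "open N" "p \<in> N" "N \<subseteq> U" "negligible (f ` N)"
proof -
  define D where "D = blinfun_apply (f' p)"
  have blD: "bounded_linear D" unfolding D_def by (rule blinfun.bounded_linear_right)
  then have linD: "linear D" by (rule bounded_linear.linear)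
  obtain S where S: "linear S" "\<forall>v\<in>range D. D (S v) = v"
    using linear_exists_right_inverse_on[OF linD subspace_UNIV] by auto
  have blS: "bounded_linear S" using S(1) by (simp add: linear_conv_bounded_linear)
  have DSD: "D (S (D v)) = D v" for v using S by simp
  define P where "P = (\<lambda>x. x - S (D x))"
  have blP: "bounded_linear P" unfolding P_def
    by (intro bounded_linear_sub bounded_linear_ident bounded_linear_compose[OF blS blD])
  define \<Phi> where "\<Phi> x = P x + S (f x)" for x
  define \<Phi>' where "\<Phi>' x = Blinfun P + (Blinfun S o\<^sub>L f' x)" for x
  have 1: "(\<Phi> has_derivative blinfun_apply (\<Phi>' x)) (at x)" if "x \<in> U" for x
    using has_derivative_add[OF bounded_linear_imp_has_derivative[OF blP]
        bounded_linear.has_derivative[OF blS d[OF that]]]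
    by (simp add: \<Phi>'_def \<Phi>_def[abs_def] bounded_linear_Blinfun_apply blP blS o_def
        blinfun_apply_blinfun_compose[abs_def] blinfun.add_left[abs_def])
  have 2: "continuous_on U \<Phi>'" unfolding \<Phi>'_def by (intro continuous_intros cd)
  \<comment> \<open>At \<open>p\<close> the derivative is \<open>P + S \<circ> D\<close>, which is
    the identity by the definition of \<open>P\<close>.\<close>
  have 3: "id_blinfun o\<^sub>L \<Phi>' p = id_blinfun"
    by (rule blinfun_eqI)
      (simp add: \<Phi>'_def bounded_linear_Blinfun_apply blP blS blinfun.add_left D_def[symmetric],
        simp add: P_def)
  obtain U' V \<Psi> \<Psi>' where U': "open U'" "U' \<subseteq> U" "p \<in> U'" "open V" "\<Phi> p \<in> V"
    "homeomorphism U' V \<Phi> \<Psi>" "\<And>y. y \<in> V \<Longrightarrow> (\<Psi> has_derivative \<Psi>' y) (at y)"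
    "\<And>y. y \<in> V \<Longrightarrow> \<Psi>' y = inv (blinfun_apply (\<Phi>' (\<Psi> y)))"
    "\<And>y. y \<in> V \<Longrightarrow> bij (blinfun_apply (\<Phi>' (\<Psi> y)))"
    by (rule inverse_function_theorem[OF assms(1) 1 2 assms(2) 3]) (assumption, (rule that; (assumption | simp)))
  have inv: "\<And>y. y \<in> V \<Longrightarrow> \<Psi> y \<in> U' \<and> \<Phi> (\<Psi> y) = y" "\<And>x. x \<in> U' \<Longrightarrow> \<Phi> x \<in> V \<and> \<Psi> (\<Phi> x) = x"
    using U'(6) by (auto simp: homeomorphism_def)
  define g where "g y = f (\<Psi> y)" for y
  define g' where "g' y v = blinfun_apply (f' (\<Psi> y)) (\<Psi>' y v)" for y v
  have dg: "(g has_derivative g' y) (at y)" if "y \<in> V" for y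
    unfolding g_def g'_def using inv(1)[OF that] U'(2)
    by (intro has_derivative_compose[OF U'(7)[OF that]] d) blast
  \<comment> \<open>Since \<open>D \<circ> P = 0\<close>, applying \<open>D\<close> to
    \<open>\<Phi>' (\<Psi>' w) = w\<close> gives \<open>D (S (g' y w)) = D w\<close>. So
    \<open>D \<circ> S\<close> maps the range of \<open>g' y\<close> onto that of \<open>D\<close>.
    Both have dimension \<open>r\<close>, so it is injective there, and \<open>D v = 0\<close>
    forces \<open>g' y v = 0\<close>.\<close>
  have ker: "g' y v = 0" if y: "y \<in> V" and v: "D v = 0" for y v
  proof -
    have PsiU: "\<Psi> y \<in> U" using inv(1)[OF y] U'(2) by blast
    have surj: "surj (\<Psi>' y)" using U'(8,9)[OF y] by (simp add: bij_imp_bij_inv bij_is_surj)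
    have "range (g' y) = range (blinfun_apply (f' (\<Psi> y)))"
      unfolding g'_def using surj by (metis image_image)
    then have dimg: "dim (range (g' y)) = r" using rank[OF PsiU] by simp
    have ling: "linear (g' y)" using dg[OF y] by (rule has_derivative_linear)
    have dphi: "blinfun_apply (\<Phi>' (\<Psi> y)) (\<Psi>' y w) = w" for w
      using U'(8,9)[OF y] by (simp add: bij_is_surj surj_f_inv_f)
    have DSg: "D (S (g' y w)) = D w" for w
    proof -
      have "D w = D (P (\<Psi>' y w) + S (g' y w))"
        using dphi[of w] by (simp add: \<Phi>'_def g'_def blinfun.add_left bounded_linear_Blinfun_apply blP blS)
      also have "\<dots> = D (S (g' y w))"
        by (simp add: P_def linear_add[OF linD] linear_diff[OF linD] DSD)
      finally show ?thesis by simp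
    qed
    have linDS: "linear (D \<circ> S)" using S(1) linD by (rule linear_compose)
    have "(D \<circ> S) ` range (g' y) = range D" using DSg by (auto simp: image_image)
    moreover have "dim (range D) = r" unfolding D_def using rank assms(2) by simp
    ultimately have "inj_on (D \<circ> S) (range (g' y))"
      using dimg ling linDS
      by (intro linear_inj_on_subspace_if_dim_image) (auto intro: linear_subspace_image)
    moreover have "(D \<circ> S) (g' y v) = (D \<circ> S) (g' y 0)" using DSg v by (simp add: linear_0[OF linD])
    ultimately show ?thesis by (metis inj_on_def linear_0[OF ling] rangeI)
  qed
  define w where "w = \<Phi> p"
  obtain e where e: "e > 0" "ball w e \<subseteq> V" using U'(4,5) unfolding w_def by (meson open_contains_ball)
  have "bounded_linear (\<lambda>u. S (D u))" by (intro bounded_linear_compose[OF blS blD])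
  then obtain K where K: "K > 0" "\<And>u. norm (S (D u)) \<le> norm u * K"
    using bounded_linear.pos_bounded by blast
  \<comment> \<open>With this radius both \<open>y\<close> and its projection
    \<open>w + S (D (y - w))\<close> lie in the ball of radius \<open>e\<close>, and so does the
    segment between them, by convexity.\<close>
  define \<delta> where "\<delta> = e / (1 + K)"
  have \<delta>: "\<delta> > 0" "\<delta> \<le> e" "\<delta> * K < e"
    using e K unfolding \<delta>_def by (auto simp: field_simps)
  have factor: "g y = g (w + S (D (y - w)))" "w + S (D (y - w)) \<in> ball w e" "y \<in> ball w e"
    if y: "y \<in> ball w \<delta>" for y
  proof -
    show y1: "y \<in> ball w e" using y \<delta> by auto
    have n: "norm (y - w) < \<delta>" using y by (simp add: dist_norm norm_minus_commute)
    have "norm (S (D (y - w))) \<le> norm (y - w) * K" by (rule K)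
    also have "\<dots> < e" using n \<delta> K mult_strict_right_mono[OF n K(1)] by linarith
    finally show y2: "w + S (D (y - w)) \<in> ball w e" by (simp add: dist_norm)
    define u where "u = y - (w + S (D (y - w)))"
    have "D (y - (w + x)) = D (y - w) - D x" for x
      by (simp add: linear_diff[OF linD] linear_add[OF linD])
    then have Du: "D u = 0" by (simp only: u_def DSD diff_self)
    have seg: "w + S (D (y - w)) + t *\<^sub>R u \<in> ball w e" if t: "t \<in> {0..1}" for t
    proof -
      have "(1 - t) *\<^sub>R (w + S (D (y - w))) + t *\<^sub>R y \<in> ball w e"
        using t by (intro convexD_alt[OF convex_ball y2 y1]) auto
      then show ?thesis by (simp add: u_def algebra_simps)
    qed
    \<comment> \<open>The direction \<open>u\<close> of the segment is in the kernel of
      \<open>D\<close>, so \<open>g\<close> has derivative zero along it.\<close>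
    have "\<exists>c. \<forall>t\<in>{0..1}. g (w + S (D (y - w)) + t *\<^sub>R u) = c"
    proof (rule has_derivative_zero_constant)
      fix t :: real assume t: "t \<in> {0..1}"
      have inV: "w + S (D (y - w)) + t *\<^sub>R u \<in> V" using seg[OF t] e(2) by blast
      have "((\<lambda>t. g (w + S (D (y - w)) + t *\<^sub>R u)) has_vector_derivative
          g' (w + S (D (y - w)) + t *\<^sub>R u) u) (at t)"
        by (rule has_vector_derivative_compose_has_derivative[where \<gamma>="\<lambda>t. w + S (D (y - w)) + t *\<^sub>R u",
              OF _ dg[OF inV]])
          (auto intro!: derivative_eq_intros)
      then show "((\<lambda>t. g (w + S (D (y - w)) + t *\<^sub>R u)) has_derivative (\<lambda>h. 0)) (at t within {0..1})"
        unfolding ker[OF inV Du] has_vector_derivative_def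
        by (simp add: has_derivative_at_withinI)
    qed auto
    then have "g (w + S (D (y - w)) + 1 *\<^sub>R u) = g (w + S (D (y - w)) + 0 *\<^sub>R u)"
      by (metis atLeastAtMost_iff order_refl zero_le_one)
    then show "g y = g (w + S (D (y - w)))" by (simp add: u_def)
  qed
  \<comment> \<open>\<open>Z\<close> lies in the proper subspace \<open>range D\<close> of the
    target space of \<open>f\<close>, so it is a null set there. The map
    \<open>y \<mapsto> g (w + S y)\<close> goes from this space to itself, and a differentiable map
    between spaces of equal dimension preserves null sets.\<close>
  define Z where "Z = {y \<in> range D. w + S y \<in> V}"
  have "dim (range D) < DIM('b)" unfolding D_def using rank assms by simp
  then have "negligible (range D)" by (rule negligible_lowdim)
  then have negZ: "negligible Z" by (rule negligible_subset) (auto simp: Z_def)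
  have "(\<lambda>y. g (w + S y)) differentiable_on Z"
    unfolding differentiable_on_def
  proof
    fix y assume "y \<in> Z"
    then have "(\<lambda>y. g (w + S y)) differentiable (at y)"
      unfolding differentiable_def Z_def
      using has_derivative_compose[OF has_derivative_add[OF has_derivative_const
            bounded_linear_imp_has_derivative[OF blS]] dg] by blast
    then show "(\<lambda>y. g (w + S y)) differentiable (at y within Z)"
      by (rule differentiable_at_withinI)
  qed
  then have negim: "negligible ((\<lambda>y. g (w + S y)) ` Z)"
    by (intro negligible_differentiable_image_negligible negZ) auto
  define N where "N = U' \<inter> \<Phi> -` ball w \<delta>"
  have contPhi: "continuous_on U' \<Phi>" using U'(6) by (simp add: homeomorphism_def)
  show ?thesis
  proof
    show "open N" unfolding N_def
      by (rule continuous_open_preimage[OF contPhi U'(1)]) simp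
    show "p \<in> N" "N \<subseteq> U" using U' \<delta> by (auto simp: N_def w_def)
    have "f x \<in> (\<lambda>y. g (w + S y)) ` Z" if x: "x \<in> N" for x
    proof (rule image_eqI)
      have b: "\<Phi> x \<in> ball w \<delta>" and "\<Psi> (\<Phi> x) = x" using x inv(2) by (auto simp: N_def)
      then show "f x = g (w + S (D (\<Phi> x - w)))" using factor(1)[OF b] by (simp add: g_def)
      show "D (\<Phi> x - w) \<in> Z" using factor(2)[OF b] e(2) by (auto simp: Z_def)
    qed
    then show "negligible (f ` N)" by (intro negligible_subset[OF negim]) blast
  qed
qed

section \<open>Lifting curves and counting dimensions\<close>

text \<open>The lift is \<open>\<sigma> \<circ> b \<circ> c\<close>, where \<open>\<sigma>\<close>
  is a local section of \<open>a\<close> through \<open>p\<close>. Its velocity is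
  \<open>\<sigma>' (b w) = \<sigma>' 0 = 0\<close>.\<close>

lemma lift_curve:
  fixes T :: "'a::euclidean_space topology" and a b :: "'a \<Rightarrow> 'b::euclidean_space"
  assumes "submanifold k T" "p \<in> topspace T" "linear a" "a ` tangent_space T p = UNIV"
    and "linear b" "continuous_map T euclidean b"
    and c: "weak_tangent_curve T q w c" and "b q = a p" "b w = 0"
  obtains \<gamma> e where "weak_tangent_curve T p 0 \<gamma>" "e > 0"
    "\<forall>t\<in>{-e<..<e}. a (\<gamma> t) = b (c t)"
proof -
  obtain N \<sigma> \<sigma>' where N: "open N" "a p \<in> N" and \<sigma>: "\<sigma> (a p) = p"
    "continuous_map (top_of_set N) T \<sigma>" "(\<sigma> has_derivative \<sigma>') (at (a p))"
    "\<forall>y\<in>N. a (\<sigma> y) = y"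
    by (rule submersion_local_section[OF assms(1-4)])
  have c0: "c 0 = q" "(c has_vector_derivative w) (at 0)"
    using c unfolding weak_tangent_curve_def by auto
  have "q \<in> topspace T"
  proof -
    obtain e :: real where "e > 0" "continuous_map (top_of_set {-e<..<e}) T c"
      using c unfolding weak_tangent_curve_def by blast
    then show ?thesis using continuous_map_image_subset_topspace[of "top_of_set {-e<..<e}" T c] c0
      by (auto simp: image_subset_iff Pi_iff)
  qed
  then have q: "q \<in> {x \<in> topspace T. b x \<in> N}" using assms(8) N by simp
  have "openin T {x \<in> topspace T. b x \<in> N}"
    using openin_continuous_map_preimage[OF assms(6)] N by simp
  from c this q obtain e where e: "e > 0" "continuous_map (top_of_set {-e<..<e}) T c"
    "c ` {-e<..<e} \<subseteq> {x \<in> topspace T. b x \<in> N}"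
    by (rule weak_tangent_curve_eventually)
  show ?thesis
  proof
    have "continuous_on {-e<..<e} (b \<circ> c)"
      using continuous_map_compose[OF e(2) assms(6)] by simp
    then have "continuous_map (top_of_set {-e<..<e}) (top_of_set N) (b \<circ> c)"
      using e(3) by (auto simp: image_subset_iff)
    then have "continuous_map (top_of_set {-e<..<e}) T (\<sigma> \<circ> (b \<circ> c))"
      by (rule continuous_map_compose[OF _ \<sigma>(2)])
    moreover have "((\<lambda>t. \<sigma> (b (c t))) has_vector_derivative \<sigma>' 0) (at 0)"
    proof (rule has_vector_derivative_compose_has_derivative[where f=\<sigma> and \<gamma>="\<lambda>t. b (c t)"])
      show "((\<lambda>t. b (c t)) has_vector_derivative 0) (at 0)"
        using has_vector_derivative_compose_has_derivative[OF c0(2) linear_imp_has_derivative[OF assms(5)]]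
          assms(9) by simp
    qed (use \<sigma> c0 assms(8) in simp)
    moreover have "\<sigma>' 0 = 0" using \<sigma>(3) by (simp add: has_derivative_linear linear_0)
    ultimately show "weak_tangent_curve T p 0 (\<lambda>t. \<sigma> (b (c t)))"
      unfolding weak_tangent_curve_def using e(1) c0 assms(8) \<sigma>(1) by (auto simp: o_def)
    show "\<forall>t\<in>{-e<..<e}. a (\<sigma> (b (c t))) = b (c t)"
      using e(3) \<sigma>(4) by auto
  qed (rule e)
qed

text \<open>A linear section of \<open>a\<close> with values in \<open>R\<close> splits
  \<open>R\<close> into the direct sum of its range and the kernel of \<open>a\<close> in
  \<open>R\<close>.\<close>

lemma rank_nullity_on_subspace:
  fixes a :: "'a::euclidean_space \<Rightarrow> 'b::euclidean_space"
  assumes "linear a" "subspace R" "a ` R = UNIV"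
  shows "dim R = DIM('b) + dim {v \<in> R. a v = 0}"
proof -
  obtain g where g: "range g \<subseteq> R" "linear g" "\<forall>v\<in>a ` R. a (g v) = v"
    using linear_exists_right_inverse_on[OF assms(1,2)] by blast
  have ag: "a (g v) = v" for v using g(3) assms(3) by blast
  have subs: "subspace {v \<in> R. a v = 0}"
    using assms(1,2) unfolding subspace_def by (auto simp: linear_0 linear_add linear_scale)
  have subg: "subspace (range g)" using g(2) by (simp add: linear_subspace_image)
  have "R = {x + y |x y. x \<in> range g \<and> y \<in> {v \<in> R. a v = 0}}" (is "_ = ?S")
  proof
    show "R \<subseteq> ?S"
    proof
      fix v assume "v \<in> R"
      then have "v - g (a v) \<in> {v \<in> R. a v = 0}"
        using g(1) assms ag by (auto simp: linear_diff intro!: subspace_diff)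
      moreover have "v = g (a v) + (v - g (a v))" by simp
      ultimately show "v \<in> ?S" by blast
    qed
    show "?S \<subseteq> R" using g(1) assms(2) by (auto intro!: subspace_add)
  qed
  moreover have "range g \<inter> {v \<in> R. a v = 0} = {0}"
  proof
    show "range g \<inter> {v \<in> R. a v = 0} \<subseteq> {0}" using ag linear_0[OF g(2)] by auto
    show "{0} \<subseteq> range g \<inter> {v \<in> R. a v = 0}" using subs subg by (auto simp: subspace_0 dest: subspace_0)
  qed
  moreover have "dim (range g) = DIM('b)"
    using dim_image_eq[OF g(2), of UNIV] ag by (metis dim_UNIV inj_on_inverseI subset_UNIV)
  ultimately show ?thesis
    using dim_sums_Int[OF subg subs] by simp
qed

lemma tangent_space_open:
  assumes "open B" "x \<in> B"
  shows "tangent_space (top_of_set B) x = UNIV"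
proof -
  have "\<exists>\<gamma>. tangent_curve (top_of_set B) x v \<gamma>" for v
  proof -
    have "open ((\<lambda>t::real. x + t *\<^sub>R v) -` B)"
      using assms(1) by (intro open_vimage continuous_intros)
    moreover have "0 \<in> (\<lambda>t::real. x + t *\<^sub>R v) -` B" using assms(2) by simp
    ultimately obtain e where e: "e > 0" "ball (0::real) e \<subseteq> (\<lambda>t::real. x + t *\<^sub>R v) -` B"
      by (rule openE)
    have b: "ball (0::real) e = {-e<..<e}" by (auto simp: dist_real_def)
    have "tangent_curve (top_of_set B) x v (\<lambda>t. x + t *\<^sub>R v)"
      unfolding tangent_curve_def
    proof (intro conjI exI[of _ e] e)
      show "continuous_map (top_of_set {-e<..<e}) (top_of_set B) (\<lambda>t. x + t *\<^sub>R v)"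
        using e b by (auto intro!: continuous_intros)
      have "linear (\<lambda>t::real. t *\<^sub>R v)" by (simp add: linear_iff scaleR_left_distrib)
      from smooth_on_affine[OF this] show "smooth_on {-e<..<e} (\<lambda>t. x + t *\<^sub>R v)"
        by (simp add: add.commute)
      show "((\<lambda>t. x + t *\<^sub>R v) has_vector_derivative v) (at 0)"
        by (auto intro!: derivative_eq_intros)
    qed simp
    then show ?thesis by blast
  qed
  then show ?thesis unfolding tangent_space_def by blast
qed

subsection \<open>Lie groupoids with linear source and target maps\<close>

text \<open>The source and target of a jet are coordinate projections, hence linear on the ambient
  space, and on tangent vectors their tangent maps are the projections themselves. As
  \<open>B\<close> is open, its tangent spaces are the whole space.\<close>

locale linear_lie_groupoid =
  fixes G :: "('g::euclidean_space, 'm::euclidean_space) groupoid_data" and B :: "'m set"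
  assumes lie: "lie_groupoid G"
    and objects_eq: "objects G = top_of_set B"
    and open_objects: "open B"
    and linear_source: "linear (source G)"
    and linear_target: "linear (target G)"
begin

abbreviation arrow_set where "arrow_set \<equiv> topspace (arrows G)"

abbreviation tangent where "tangent \<equiv> tangent_space (arrows G)"

section \<open>Groupoid laws and cancellation\<close>

lemma groupoid: "groupoid G"
  using lie unfolding lie_groupoid_def by blast

lemma source_in: "g \<in> arrow_set \<Longrightarrow> source G g \<in> B"
  and target_in: "g \<in> arrow_set \<Longrightarrow> target G g \<in> B"
  using groupoid unfolding groupoid_def objects_eq by auto

lemma ident_in: "x \<in> B \<Longrightarrow> ident G x \<in> arrow_set"
  and source_ident: "x \<in> B \<Longrightarrow> source G (ident G x) = x"
  and target_ident: "x \<in> B \<Longrightarrow> target G (ident G x) = x"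
  using groupoid unfolding groupoid_def objects_eq by auto

lemma mult_in: "\<lbrakk>g \<in> arrow_set; h \<in> arrow_set; source G g = target G h\<rbrakk> \<Longrightarrow> mult G g h \<in> arrow_set"
  and source_mult: "\<lbrakk>g \<in> arrow_set; h \<in> arrow_set; source G g = target G h\<rbrakk> \<Longrightarrow>
    source G (mult G g h) = source G h"
  and target_mult: "\<lbrakk>g \<in> arrow_set; h \<in> arrow_set; source G g = target G h\<rbrakk> \<Longrightarrow>
    target G (mult G g h) = target G g"
  using groupoid unfolding groupoid_def by auto

lemma ginv_in: "g \<in> arrow_set \<Longrightarrow> ginv G g \<in> arrow_set"
  and source_ginv: "g \<in> arrow_set \<Longrightarrow> source G (ginv G g) = target G g"
  and target_ginv: "g \<in> arrow_set \<Longrightarrow> target G (ginv G g) = source G g"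
  using groupoid unfolding groupoid_def by auto

lemma mult_ginv_mult:
  assumes "g \<in> arrow_set" "h \<in> arrow_set" "target G g = target G h"
  shows "mult G g (mult G (ginv G g) h) = h"
proof -
  have "mult G g (mult G (ginv G g) h) = mult G (mult G g (ginv G g)) h"
    using groupoid assms ginv_in source_ginv target_ginv unfolding groupoid_def by metis
  also have "\<dots> = mult G (ident G (target G h)) h"
    using groupoid assms unfolding groupoid_def by metis
  also have "\<dots> = h" using groupoid assms unfolding groupoid_def by metis
  finally show ?thesis .
qed

lemma mult_mult_ginv:
  assumes "g \<in> arrow_set" "h \<in> arrow_set" "source G g = source G h"
  shows "mult G (mult G h (ginv G g)) g = h"
proof -
  have "mult G (mult G h (ginv G g)) g = mult G h (mult G (ginv G g) g)"
    using groupoid assms ginv_in source_ginv target_ginv unfolding groupoid_def by metis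
  also have "\<dots> = mult G h (ident G (source G h))"
    using groupoid assms unfolding groupoid_def by metis
  also have "\<dots> = h" using groupoid assms unfolding groupoid_def by metis
  finally show ?thesis .
qed

section \<open>Tangent vectors at arrows and at products of arrows\<close>

lemma submanifold_arrows: obtains k where "submanifold k (arrows G)"
  using lie unfolding lie_groupoid_def by blast

lemma source_tangent:
  assumes "g \<in> arrow_set"
  shows "source G ` tangent g = UNIV"
proof -
  have "tangent_map (arrows G) (source G) g ` tangent g = UNIV"
    using lie assms source_in[OF assms] open_objects
    unfolding lie_groupoid_def submersion_def objects_eq by (simp add: tangent_space_open)
  then show ?thesis using tangent_map_linear[OF linear_source] by (simp cong: image_cong)
qed

lemma target_tangent:
  assumes "g \<in> arrow_set"
  shows "target G ` tangent g = UNIV"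
proof -
  have "tangent_map (arrows G) (target G) g ` tangent g = UNIV"
    using lie assms target_in[OF assms] open_objects
    unfolding lie_groupoid_def submersion_def objects_eq by (simp add: tangent_space_open)
  then show ?thesis using tangent_map_linear[OF linear_target] by (simp cong: image_cong)
qed

lemma continuous_source: "continuous_map (arrows G) euclidean (source G)"
  and continuous_target: "continuous_map (arrows G) euclidean (target G)"
  using lie unfolding lie_groupoid_def submersion_def smooth_map_def objects_eq
  by (auto simp: continuous_map_in_subtopology)

text \<open>The vector \<open>u\<close> is the velocity of the product curve
  \<open>t \<mapsto> mult G (c t) (\<gamma> t)\<close>. Its sources are those of
  \<open>\<gamma>\<close> and its targets those of \<open>c\<close>, and the linear maps
  \<open>source G\<close> and \<open>target G\<close> carry this over to velocities.\<close>

lemma tangent_mult: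
  assumes g: "g \<in> arrow_set" and h: "h \<in> arrow_set"
    and c: "weak_tangent_curve (arrows G) g w c" and \<gamma>: "weak_tangent_curve (arrows G) h v \<gamma>"
    and "d > 0" and comp: "\<forall>t\<in>{-d<..<d}. source G (c t) = target G (\<gamma> t)"
  obtains u where "u \<in> tangent (mult G g h)" "source G u = source G v" "target G u = target G w"
proof -
  have sm: "smooth_map (composable_pairs G) (arrows G) (\<lambda>(g, h). mult G g h)"
    using lie unfolding lie_groupoid_def by blast
  have c0: "c 0 = g" "(c has_vector_derivative w) (at 0)"
    and g0: "\<gamma> 0 = h" "(\<gamma> has_vector_derivative v) (at 0)"
    using c \<gamma> unfolding weak_tangent_curve_def by auto
  have gh: "source G g = target G h" using bspec[OF comp, of 0] \<open>d > 0\<close> c0 g0 by simp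
  then have gh_top: "(g, h) \<in> topspace (composable_pairs G)"
    using g h unfolding composable_pairs_def by simp
  have pair: "weak_tangent_curve (composable_pairs G) (g, h) (w, v) (\<lambda>t. (c t, \<gamma> t))"
    unfolding weak_tangent_curve_def
  proof (intro conjI)
    obtain e1 where e1: "e1 > 0" "continuous_map (top_of_set {-e1<..<e1}) (arrows G) c"
      using c unfolding weak_tangent_curve_def by blast
    obtain e2 where e2: "e2 > 0" "continuous_map (top_of_set {-e2<..<e2}) (arrows G) \<gamma>"
      using \<gamma> unfolding weak_tangent_curve_def by blast
    define e where "e = min d (min e1 e2)"
    have "continuous_map (top_of_set {-e<..<e}) (arrows G) c"
      by (rule continuous_map_from_subtopology_mono[OF e1(2)]) (auto simp: e_def)
    moreover have "continuous_map (top_of_set {-e<..<e}) (arrows G) \<gamma>"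
      by (rule continuous_map_from_subtopology_mono[OF e2(2)]) (auto simp: e_def)
    ultimately have "continuous_map (top_of_set {-e<..<e}) (composable_pairs G) (\<lambda>t. (c t, \<gamma> t))"
      unfolding composable_pairs_def continuous_map_in_subtopology
      using comp by (auto intro: continuous_map_pairedI simp: e_def)
    moreover have "e > 0" using \<open>d > 0\<close> e1 e2 by (simp add: e_def)
    ultimately show "\<exists>e>0. continuous_map (top_of_set {-e<..<e}) (composable_pairs G) (\<lambda>t. (c t, \<gamma> t))"
      by blast
    show "((\<lambda>t. (c t, \<gamma> t)) has_vector_derivative (w, v)) (at 0)"
      using c0 g0 by (intro has_vector_derivative_Pair)
  qed (use c0 g0 in simp)
  obtain U N F where U: "openin (composable_pairs G) U" "(g, h) \<in> U" "open N" "U \<subseteq> N"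
    and F: "smooth_on N F" "\<forall>q\<in>U. F q = (case q of (g, h) \<Rightarrow> mult G g h)"
    using bspec[OF conjunct2[OF sm[unfolded smooth_map_def]] gh_top] by (elim exE conjE)
  obtain F' where F': "\<forall>q\<in>N. (F has_derivative blinfun_apply (F' q)) (at q)" "continuous_on N F'"
    by (rule smooth_on_imp_C1[OF F(1)])
  obtain e where e: "e > 0" "continuous_map (top_of_set {-e<..<e}) (composable_pairs G) (\<lambda>t. (c t, \<gamma> t))"
    "(\<lambda>t. (c t, \<gamma> t)) ` {-e<..<e} \<subseteq> U"
    by (rule weak_tangent_curve_eventually[OF pair U(1,2)])
  define \<delta> where "\<delta> t = mult G (c t) (\<gamma> t)" for t
  \<comment> \<open>\<open>F\<close> extends the product to an open set of the ambient space, so it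
    has an ordinary derivative at \<open>(g, h)\<close>, and the chain rule applies to the pair of
    curves.\<close>
  define u where "u = blinfun_apply (F' (g, h)) (w, v)"
  have cont: "continuous_map (top_of_set {-e<..<e}) (arrows G) \<delta>"
    using continuous_map_compose[OF e(2), of "arrows G" "\<lambda>(g, h). mult G g h"] sm
    unfolding smooth_map_def \<delta>_def[abs_def] by (simp add: o_def)
  have F'gh: "(F has_derivative blinfun_apply (F' (g, h))) (at (c 0, \<gamma> 0))"
    using F' U c0 g0 by auto
  have "((\<lambda>t. F (c t, \<gamma> t)) has_vector_derivative u) (at 0)"
    unfolding u_def
    by (rule has_vector_derivative_compose_has_derivative[where f=F and \<gamma>="\<lambda>t. (c t, \<gamma> t)",
          OF has_vector_derivative_Pair[OF c0(2) g0(2)] F'gh])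
  then have du: "(\<delta> has_vector_derivative u) (at 0)"
  proof (rule has_vector_derivative_transform_within_open)
    show "0 \<in> {-e<..<e}" using e by simp
    show "F (c t, \<gamma> t) = \<delta> t" if "t \<in> {-e<..<e}" for t
      using F(2) e(3) that by (simp add: \<delta>_def image_subset_iff)
  qed simp
  obtain k where k: "submanifold k (arrows G)" by (rule submanifold_arrows)
  have "weak_tangent_curve (arrows G) (mult G g h) u \<delta>"
    unfolding weak_tangent_curve_def using cont e(1) du c0 g0 by (auto simp: \<delta>_def)
  then have u: "u \<in> tangent (mult G g h)"
    using tangent_space_iff_weak_tangent_curve[OF k mult_in[OF g h gh]] by blast
  have comp_e: "c t \<in> arrow_set \<and> \<gamma> t \<in> arrow_set \<and> source G (c t) = target G (\<gamma> t)"
    if "t \<in> {-e<..<e}" for t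
  proof -
    have "(c t, \<gamma> t) \<in> topspace (composable_pairs G)"
      using e(3) openin_subset[OF U(1)] that by blast
    then show ?thesis unfolding composable_pairs_def by auto
  qed
  have 0: "0 \<in> {-e<..<e}" "open {-e<..<e}" using e(1) by auto
  have "((\<lambda>t. source G (\<gamma> t)) has_vector_derivative source G v) (at 0)"
    by (rule has_vector_derivative_compose_has_derivative[OF g0(2) linear_imp_has_derivative[OF linear_source]])
  then have "((\<lambda>t. source G (\<delta> t)) has_vector_derivative source G v) (at 0)"
    by (rule has_vector_derivative_transform_within_open[OF _ 0(2,1)])
      (use comp_e source_mult in \<open>simp add: \<delta>_def\<close>)
  then have s: "source G u = source G v"
    using has_vector_derivative_compose_has_derivative[OF du linear_imp_has_derivative[OF linear_source]]
    by (rule vector_derivative_unique_at[symmetric])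
  have "((\<lambda>t. target G (c t)) has_vector_derivative target G w) (at 0)"
    by (rule has_vector_derivative_compose_has_derivative[OF c0(2) linear_imp_has_derivative[OF linear_target]])
  then have "((\<lambda>t. target G (\<delta> t)) has_vector_derivative target G w) (at 0)"
    by (rule has_vector_derivative_transform_within_open[OF _ 0(2,1)])
      (use comp_e target_mult in \<open>simp add: \<delta>_def\<close>)
  then have t: "target G u = target G w"
    using has_vector_derivative_compose_has_derivative[OF du linear_imp_has_derivative[OF linear_target]]
    by (rule vector_derivative_unique_at[symmetric])
  show ?thesis using that u s t by blast
qed

section \<open>Velocities of the ends of arrows\<close>

definition ends :: "'g \<Rightarrow> 'm \<times> 'm" where
  "ends g = (source G g, target G g)"

lemma linear_ends: "linear ends"
  unfolding ends_def[abs_def] using linear_source linear_target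
  by (simp add: linear_iff)

text \<open>This is the space \<open>R\<^sub>g\<close>: \<open>ends\<close> is the map (\<alpha>,
  \<beta>), and being linear it is its own differential.\<close>

definition end_velocities :: "'g \<Rightarrow> ('m \<times> 'm) set" where
  "end_velocities g = ends ` tangent g"

lemma subspace_end_velocities:
  assumes "g \<in> arrow_set"
  shows "subspace (end_velocities g)"
  unfolding end_velocities_def
  by (rule submanifold_arrows)
    (intro linear_subspace_image linear_ends subspace_tangent_space[OF _ assms])

lemma fst_end_velocities: "g \<in> arrow_set \<Longrightarrow> fst ` end_velocities g = UNIV"
  and snd_end_velocities: "g \<in> arrow_set \<Longrightarrow> snd ` end_velocities g = UNIV"
  using source_tangent target_tangent unfolding end_velocities_def ends_def by (simp_all add: image_image)

text \<open>
  If \<open>w = c'(0)\<close> is in the kernel of the differential of the source map, then \<open>c\<close> can be multiplied by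
  a curve \<open>\<gamma>\<close> through \<open>h\<close> with \<open>\<gamma>'(0) = 0\<close> whose targets follow the sources of \<open>c\<close>.
\<close>

lemma end_velocities_left_mult:
  assumes g: "g \<in> arrow_set" and h: "h \<in> arrow_set" and gh: "source G g = target G h"
    and "(0, y) \<in> end_velocities g"
  shows "(0, y) \<in> end_velocities (mult G g h)"
proof -
  obtain k where k: "submanifold k (arrows G)" by (rule submanifold_arrows)
  obtain w where w: "w \<in> tangent g" "source G w = 0" "target G w = y"
    using assms(4) unfolding end_velocities_def ends_def by auto
  obtain c where c: "weak_tangent_curve (arrows G) g w c"
    using w(1) tangent_space_iff_weak_tangent_curve[OF k g] by blast
  obtain \<gamma> e where *: "weak_tangent_curve (arrows G) h 0 \<gamma>" "e > 0"
    "\<forall>t\<in>{-e<..<e}. target G (\<gamma> t) = source G (c t)"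
    by (rule lift_curve[OF k h linear_target target_tangent[OF h] linear_source continuous_source
          c gh w(2)])
  obtain u where "u \<in> tangent (mult G g h)" "source G u = source G 0" "target G u = target G w"
    by (rule tangent_mult[OF g h c *(1,2)]) (use *(3) in auto)
  then show ?thesis
    using w linear_0[OF linear_source] unfolding end_velocities_def ends_def
    by (metis (no_types, lifting) image_eqI)
qed

text \<open>The mirror image of \<open>end_velocities_left_mult\<close>: the curve through
  \<open>h\<close> keeps its targets fixed to first order, so a curve through \<open>g\<close> with
  velocity \<open>0\<close> can follow them with its sources.\<close>

lemma end_velocities_right_mult:
  assumes g: "g \<in> arrow_set" and h: "h \<in> arrow_set" and gh: "source G g = target G h"
    and "(x, 0) \<in> end_velocities h"
  shows "(x, 0) \<in> end_velocities (mult G g h)"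
proof -
  obtain k where k: "submanifold k (arrows G)" by (rule submanifold_arrows)
  obtain v where v: "v \<in> tangent h" "source G v = x" "target G v = 0"
    using assms(4) unfolding end_velocities_def ends_def by auto
  obtain \<gamma> where \<gamma>: "weak_tangent_curve (arrows G) h v \<gamma>"
    using v(1) tangent_space_iff_weak_tangent_curve[OF k h] by blast
  obtain c e where *: "weak_tangent_curve (arrows G) g 0 c" "e > 0"
    "\<forall>t\<in>{-e<..<e}. source G (c t) = target G (\<gamma> t)"
    by (rule lift_curve[OF k g linear_source source_tangent[OF g] linear_target continuous_target
          \<gamma> gh[symmetric] v(3)])
  obtain u where "u \<in> tangent (mult G g h)" "source G u = source G v" "target G u = target G 0"
    by (rule tangent_mult[OF g h *(1) \<gamma> *(2,3)])
  then show ?thesis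
    using v linear_0[OF linear_target] unfolding end_velocities_def ends_def
    by (metis (no_types, lifting) image_eqI)
qed

text \<open>Writing \<open>k\<close> as the product of \<open>g\<close> and
  \<open>mult G (ginv G g) k\<close> carries the vectors \<open>(0, y)\<close> from \<open>g\<close>
  to \<open>k\<close>, and by symmetry back. They form the kernel of the surjective projection
  \<open>fst\<close>, so they determine the dimension.\<close>

lemma dim_end_velocities_same_target:
  assumes "g \<in> arrow_set" "h \<in> arrow_set" "target G g = target G h"
  shows "dim (end_velocities g) = dim (end_velocities h)"
proof -
  have "(0, y) \<in> end_velocities k"
    if "(0, y) \<in> end_velocities g" "g \<in> arrow_set" "k \<in> arrow_set" "target G g = target G k" for g k y
    using end_velocities_left_mult[of g "mult G (ginv G g) k" y] that mult_ginv_mult[of g k]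
    by (simp add: ginv_in mult_in source_ginv target_ginv target_mult)
  then have "{v \<in> end_velocities g. fst v = 0} = {v \<in> end_velocities h. fst v = 0}"
    using assms by (auto simp: prod_eq_iff)
  then show ?thesis
    using rank_nullity_on_subspace[OF linear_fst subspace_end_velocities fst_end_velocities] assms
    by simp
qed

text \<open>The same argument with \<open>k\<close> as the product of
  \<open>mult G k (ginv G g)\<close> and \<open>g\<close>, and with the kernel of
  \<open>snd\<close>.\<close>

lemma dim_end_velocities_same_source:
  assumes "g \<in> arrow_set" "h \<in> arrow_set" "source G g = source G h"
  shows "dim (end_velocities g) = dim (end_velocities h)"
proof -
  have "(x, 0) \<in> end_velocities k"
    if "(x, 0) \<in> end_velocities g" "g \<in> arrow_set" "k \<in> arrow_set" "source G g = source G k" for g k x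
    using end_velocities_right_mult[of "mult G k (ginv G g)" g x] that mult_mult_ginv[of g k]
    by (simp add: ginv_in mult_in source_ginv target_ginv source_mult)
  then have "{v \<in> end_velocities g. snd v = 0} = {v \<in> end_velocities h. snd v = 0}"
    using assms by (auto simp: prod_eq_iff)
  then show ?thesis
    using rank_nullity_on_subspace[OF linear_snd subspace_end_velocities snd_end_velocities] assms
    by simp
qed

section \<open>The map (\<alpha>, \<beta>) in local coordinates\<close>

text \<open>\<open>f\<close> is \<open>ends \<circ> \<psi>\<close> precomposed with a linear
  projection \<open>\<pi>\<close> onto \<open>L\<close>. It lives on an open set of the ambient
  space, where the open mapping and constant rank results apply, and its derivative has the range
  \<open>end_velocities\<close> because \<open>\<pi>\<close> is onto \<open>L\<close>.\<close>

lemma arrow_chart: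
  assumes "p \<in> arrow_set"
  obtains U f z and f' :: "'g \<Rightarrow> 'g \<Rightarrow>\<^sub>L ('m \<times> 'm)"
  where "open U" "z \<in> U"
    "\<forall>x\<in>U. (f has_derivative blinfun_apply (f' x)) (at x)" "continuous_on U f'"
    "\<forall>x\<in>U. \<exists>q\<in>arrow_set. f x = ends q \<and> range (blinfun_apply (f' x)) = end_velocities q"
    "f z = ends p" "range (blinfun_apply (f' z)) = end_velocities p"
    "\<forall>N. open N \<longrightarrow> z \<in> N \<longrightarrow> N \<subseteq> U \<longrightarrow> (\<exists>W. openin (arrows G) W \<and> p \<in> W \<and> ends ` W \<subseteq> f ` N)"
proof -
  obtain k where k: "submanifold k (arrows G)" by (rule submanifold_arrows)
  obtain V L \<psi> \<psi>' z where par: "parametrization (arrows G) V L \<psi> \<psi>'" and z: "z \<in> V \<inter> L" "\<psi> z = p"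
    by (rule submanifold_parametrization[OF k assms])
  then have V: "open V" "subspace L"
    and d: "\<forall>x\<in>V. (\<psi> has_derivative blinfun_apply (\<psi>' x)) (at x)"
    and cd: "continuous_on V \<psi>'"
    and op: "\<forall>W. open W \<longrightarrow> W \<subseteq> V \<longrightarrow> openin (arrows G) (\<psi> ` (W \<inter> L))"
    and tan: "\<forall>x\<in>V \<inter> L. tangent (\<psi> x) = blinfun_apply (\<psi>' x) ` L"
    unfolding parametrization_def by auto
  \<comment> \<open>A right inverse of the identity on \<open>L\<close> with values in
    \<open>L\<close> is a projection onto \<open>L\<close>.\<close>
  obtain \<pi> :: "'g \<Rightarrow> 'g" where \<pi>: "range \<pi> \<subseteq> L" "linear \<pi>" "\<forall>v\<in>L. \<pi> v = v"
    using linear_exists_right_inverse_on[OF linear_ident V(2)] by auto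
  have bl: "bounded_linear \<pi>" "bounded_linear ends"
    using \<pi>(2) linear_ends by (simp_all add: linear_conv_bounded_linear)
  define U where "U = \<pi> -` V"
  define f where "f x = ends (\<psi> (\<pi> x))" for x
  define f' where "f' x = Blinfun ends o\<^sub>L \<psi>' (\<pi> x) o\<^sub>L Blinfun \<pi>" for x
  have contpi: "continuous_on S \<pi>" for S by (rule linear_continuous_on[OF bl(1)])
  have range_pi: "range \<pi> = L" using \<pi> by (metis image_subset_iff range_eqI subsetI subset_antisym)
  have inVL: "\<pi> x \<in> V \<inter> L" if "x \<in> U" for x using that \<pi>(1) by (auto simp: U_def)
  have app: "blinfun_apply (f' x) v = ends (blinfun_apply (\<psi>' (\<pi> x)) (\<pi> v))" for x v
    by (simp add: f'_def bounded_linear_Blinfun_apply bl)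
  have ran: "range (blinfun_apply (f' x)) = end_velocities (\<psi> (\<pi> x))" if "x \<in> U" for x
  proof -
    have "range (blinfun_apply (f' x)) = ends ` blinfun_apply (\<psi>' (\<pi> x)) ` range \<pi>"
      by (simp add: app image_image)
    then show ?thesis using tan inVL[OF that] by (simp add: range_pi end_velocities_def)
  qed
  have piz: "\<pi> z = z" using z \<pi>(3) by simp
  have arrow: "\<psi> x \<in> arrow_set" if "x \<in> V \<inter> L" for x
    using op V(1) that by (meson imageI openin_subset order_refl subsetD)
  show ?thesis
  proof (rule that[of U z f f'])
    show "open U" unfolding U_def using V(1) contpi by (intro open_vimage)
    show "z \<in> U" using piz z by (simp add: U_def)
    then show "range (blinfun_apply (f' z)) = end_velocities p" using ran piz z by simp
    show "f z = ends p" using piz z by (simp add: f_def)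
    show "\<forall>x\<in>U. (f has_derivative blinfun_apply (f' x)) (at x)"
    proof
      fix x assume "x \<in> U"
      then have "(\<psi> has_derivative blinfun_apply (\<psi>' (\<pi> x))) (at (\<pi> x))" using d inVL by blast
      then have "((\<lambda>x. \<psi> (\<pi> x)) has_derivative (\<lambda>v. blinfun_apply (\<psi>' (\<pi> x)) (\<pi> v))) (at x)"
        by (rule has_derivative_compose[OF bounded_linear_imp_has_derivative[OF bl(1)]])
      from bounded_linear.has_derivative[OF bl(2) this]
      show "(f has_derivative blinfun_apply (f' x)) (at x)"
        by (simp add: f_def[abs_def] app[abs_def])
    qed
    have "continuous_on U (\<lambda>x. \<psi>' (\<pi> x))"
      by (intro continuous_on_compose2[OF cd contpi]) (auto simp: U_def)
    then show "continuous_on U f'" unfolding f'_def by (intro continuous_intros)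
    show "\<forall>x\<in>U. \<exists>q\<in>arrow_set. f x = ends q \<and> range (blinfun_apply (f' x)) = end_velocities q"
      using ran arrow inVL unfolding f_def by blast
    show "\<forall>N. open N \<longrightarrow> z \<in> N \<longrightarrow> N \<subseteq> U \<longrightarrow> (\<exists>W. openin (arrows G) W \<and> p \<in> W \<and> ends ` W \<subseteq> f ` N)"
    proof (intro allI impI)
      fix N assume N: "open N" "z \<in> N" "N \<subseteq> U"
      \<comment> \<open>This is the required \<open>W\<close>: since \<open>\<pi>\<close> fixes
        \<open>L\<close>, the map \<open>f\<close> agrees with \<open>ends \<circ> \<psi>\<close>
        there.\<close>
      have "openin (arrows G) (\<psi> ` ((N \<inter> V) \<inter> L))" using op N(1) V(1) by auto
      moreover have "p \<in> \<psi> ` ((N \<inter> V) \<inter> L)" using z N by blast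
      moreover have "ends (\<psi> x) \<in> f ` N" if "x \<in> N" "x \<in> L" for x
        using that \<pi>(3) by (intro image_eqI[of _ _ x]) (auto simp: f_def)
      then have "ends ` \<psi> ` ((N \<inter> V) \<inter> L) \<subseteq> f ` N" by blast
      ultimately show "\<exists>W. openin (arrows G) W \<and> p \<in> W \<and> ends ` W \<subseteq> f ` N" by blast
    qed
  qed
qed

section \<open>Transitivity and orbits\<close>

text \<open>The image of the anchor at \<open>x\<close> consists of all \<open>y\<close> with
  \<open>(y, 0)\<close> in the end velocities. If this is everything, then so are the end
  velocities, because their second components are arbitrary.\<close>

lemma transitive_algebroid_iff:
  "transitive_algebroid (lie_algebroid G) \<longleftrightarrow> (\<forall>x\<in>B. end_velocities (ident G x) = UNIV)"
proof -
  have "anchor (lie_algebroid G) x ` fibre (lie_algebroid G) x = tangent_space (top_of_set B) x \<longleftrightarrow>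
      end_velocities (ident G x) = UNIV" if x: "x \<in> B" for x
  proof -
    have ix: "ident G x \<in> arrow_set" using x by (rule ident_in)
    have "fibre (lie_algebroid G) x = {v \<in> tangent (ident G x). target G v = 0}"
      by (auto simp: lie_algebroid_def tangent_map_linear[OF linear_target])
    then have "anchor (lie_algebroid G) x ` fibre (lie_algebroid G) x =
        source G ` {v \<in> tangent (ident G x). target G v = 0}"
      by (intro image_cong) (auto simp: lie_algebroid_def tangent_map_linear[OF linear_source])
    also have "\<dots> = {y. (y, 0) \<in> end_velocities (ident G x)}"
      unfolding end_velocities_def ends_def by auto
    finally have 1: "anchor (lie_algebroid G) x ` fibre (lie_algebroid G) x =
        {y. (y, 0) \<in> end_velocities (ident G x)}" .
    have "(y, y') \<in> end_velocities (ident G x)" if *: "\<forall>y. (y, 0) \<in> end_velocities (ident G x)" for y y'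
    proof -
      \<comment> \<open>Some velocity has second component \<open>y'\<close>; adding
        \<open>(y - y'', 0)\<close> corrects its first component.\<close>
      have "y' \<in> snd ` end_velocities (ident G x)" using snd_end_velocities[OF ix] by blast
      then obtain y'' where "(y'', y') \<in> end_velocities (ident G x)" by auto
      from subspace_add[OF subspace_end_velocities[OF ix] this *[rule_format, of "y - y''"]]
      show ?thesis by simp
    qed
    then show ?thesis unfolding 1 tangent_space_open[OF open_objects x] by auto
  qed
  then show ?thesis unfolding transitive_algebroid_def
    by (simp add: lie_algebroid_def objects_eq)
qed

definition joined :: "'m \<Rightarrow> 'm \<Rightarrow> bool" where
  "joined x y \<longleftrightarrow> (\<exists>g\<in>arrow_set. source G g = x \<and> target G g = y)"

lemma joined_if_transitive_algebroid:
  assumes "connected B" "transitive_algebroid (lie_algebroid G)" "x \<in> B" "y \<in> B"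
  shows "joined x y"
\<comment> \<open>On a connected set an equivalence relation in which every point is related to a
  whole neighbourhood has a single class.\<close>
proof (rule connected_equivalence_relation[OF assms(1,3,4)])
  show "joined b a" if "joined a b" for a b
    using that ginv_in source_ginv target_ginv unfolding joined_def by metis
  show "joined a c" if "joined a b" "joined b c" for a b c
    using that mult_in source_mult target_mult unfolding joined_def by metis
  fix a assume a: "a \<in> B"
  obtain U f z and f' :: "'g \<Rightarrow> 'g \<Rightarrow>\<^sub>L ('m \<times> 'm)" where U: "open U" "z \<in> U"
    and f: "\<forall>x\<in>U. (f has_derivative blinfun_apply (f' x)) (at x)" "continuous_on U f'"
    "\<forall>x\<in>U. \<exists>q\<in>arrow_set. f x = ends q \<and> range (blinfun_apply (f' x)) = end_velocities q"
    "f z = ends (ident G a)" "range (blinfun_apply (f' z)) = end_velocities (ident G a)"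
    "\<forall>N. open N \<longrightarrow> z \<in> N \<longrightarrow> N \<subseteq> U \<longrightarrow>
       (\<exists>W. openin (arrows G) W \<and> ident G a \<in> W \<and> ends ` W \<subseteq> f ` N)"
    by (rule arrow_chart[OF ident_in[OF a]])
  have lin: "linear (blinfun_apply (f' z))"
    by (simp add: blinfun.bounded_linear_right bounded_linear.linear)
  have "surj (blinfun_apply (f' z))" using f(5) assms(2) a transitive_algebroid_iff by simp
  then obtain g where g: "linear g" "blinfun_apply (f' z) \<circ> g = id"
    using linear_surjective_right_inverse[OF lin] by blast
  have "continuous_on U f"
    using f(1) by (intro continuous_at_imp_continuous_on ballI has_derivative_continuous) blast
  \<comment> \<open>The derivative at \<open>z\<close> is onto, hence has a right inverse
    \<open>g\<close>, and the open mapping theorem applies at \<open>z\<close>.\<close>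
  then have "f z \<in> interior (f ` U)"
    using U f(1) g by (intro sussmann_open_mapping[of U f z "blinfun_apply (f' z)" g U])
      (auto simp: linear_conv_bounded_linear interior_open)
  moreover have "f ` U \<subseteq> ends ` arrow_set" using f(3) by blast
  ultimately have "f z \<in> interior (ends ` arrow_set)" using interior_mono by blast
  then have aa: "(a, a) \<in> interior (ends ` arrow_set)"
    using f(4) a by (simp add: ends_def source_ident target_ident)
  \<comment> \<open>Fixing the source \<open>a\<close> cuts out of the neighbourhood of
    \<open>(a, a)\<close> a neighbourhood of \<open>a\<close> whose points are targets of arrows
    from \<open>a\<close>.\<close>
  define W where "W = Pair a -` interior (ends ` arrow_set)"
  have "open W" unfolding W_def by (intro open_vimage continuous_intros) simp
  moreover have "joined a x" if "x \<in> W" for x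
    using that interior_subset[of "ends ` arrow_set"] unfolding W_def joined_def ends_def by auto
  ultimately show "\<exists>W. openin (top_of_set B) W \<and> a \<in> W \<and> (\<forall>x\<in>W. joined a x)"
    using a aa by (intro exI[of _ "B \<inter> W"]) (auto simp: W_def openin_open_Int)
qed

text \<open>Sard's theorem for constant rank: for smaller \<open>r\<close> every arrow has a
  neighbourhood with null image under \<open>ends\<close>. Countably many of these cover the arrows,
  but the nonempty open set \<open>B \<times> B\<close> is not null.\<close>

lemma dim_end_velocities_if_ends_onto:
  assumes "arrow_set \<noteq> {}" "\<And>g. g \<in> arrow_set \<Longrightarrow> dim (end_velocities g) = r"
    and "ends ` arrow_set = B \<times> B"
  shows "r = DIM('m \<times> 'm)"
proof (rule ccontr)
  assume "r \<noteq> DIM('m \<times> 'm)"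
  moreover have "r \<le> DIM('m \<times> 'm)" using assms(1,2) dim_subset_UNIV by blast
  ultimately have r: "r < DIM('m \<times> 'm)" by simp
  define \<W> where "\<W> = {W. openin (arrows G) W \<and> negligible (ends ` W)}"
  have "\<exists>W\<in>\<W>. p \<in> W" if p: "p \<in> arrow_set" for p
  proof -
    obtain U f z and f' :: "'g \<Rightarrow> 'g \<Rightarrow>\<^sub>L ('m \<times> 'm)" where U: "open U" "z \<in> U"
      and f: "\<forall>x\<in>U. (f has_derivative blinfun_apply (f' x)) (at x)" "continuous_on U f'"
      "\<forall>x\<in>U. \<exists>q\<in>arrow_set. f x = ends q \<and> range (blinfun_apply (f' x)) = end_velocities q"
      "f z = ends p" "range (blinfun_apply (f' z)) = end_velocities p"
      "\<forall>N. open N \<longrightarrow> z \<in> N \<longrightarrow> N \<subseteq> U \<longrightarrow>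
         (\<exists>W. openin (arrows G) W \<and> p \<in> W \<and> ends ` W \<subseteq> f ` N)"
      by (rule arrow_chart[OF p])
    have d: "\<And>x. x \<in> U \<Longrightarrow> (f has_derivative blinfun_apply (f' x)) (at x)" using f(1) by blast
    have rank: "\<And>x. x \<in> U \<Longrightarrow> dim (range (blinfun_apply (f' x))) = r"
      using f(3) assms(2) by metis
    obtain N where N: "open N" "z \<in> N" "N \<subseteq> U" "negligible (f ` N)"
      by (rule constant_rank_locally_negligible_image[OF U d f(2) rank r])
    then obtain W where "openin (arrows G) W" "p \<in> W" "ends ` W \<subseteq> f ` N" using f(6) by blast
    then show ?thesis using negligible_subset[OF N(4)] unfolding \<W>_def by blast
  qed
  then have "\<Union>\<W> = arrow_set" unfolding \<W>_def using openin_subset by blast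
  \<comment> \<open>The second countability in the definition of a submanifold enters here; it makes
    the cover by sets of \<open>\<W>\<close> reducible to a countable one.\<close>
  moreover have "Lindelof_space (arrows G)"
    using lie second_countable_imp_Lindelof_space unfolding lie_groupoid_def submanifold_def by blast
  ultimately obtain \<V> where \<V>: "countable \<V>" "\<V> \<subseteq> \<W>" "\<Union>\<V> = arrow_set"
    using Lindelof_spaceD[of "arrows G" \<W>] unfolding \<W>_def by blast
  have "negligible (\<Union>W\<in>\<V>. ends ` W)"
    using \<V>(1,2) by (intro negligible_countable_Union) (auto simp: \<W>_def)
  moreover have "(\<Union>W\<in>\<V>. ends ` W) = B \<times> B" using \<V>(3) assms(3) by (metis image_Union)
  moreover have "open (B \<times> B)" using open_objects by (simp add: open_Times)
  moreover have "B \<times> B \<noteq> {}" using assms(1) source_in by blast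
  ultimately show False using open_not_negligible by metis
qed

theorem joined_iff_transitive_algebroid:
  assumes "connected B"
  shows "(\<forall>x\<in>B. \<forall>y\<in>B. joined x y) \<longleftrightarrow> transitive_algebroid (lie_algebroid G)"
proof
  assume j: "\<forall>x\<in>B. \<forall>y\<in>B. joined x y"
  show "transitive_algebroid (lie_algebroid G)"
    unfolding transitive_algebroid_iff
  proof
    fix x assume x: "x \<in> B"
    define r where "r = dim (end_velocities (ident G x))"
    have "dim (end_velocities g) = r" if g: "g \<in> arrow_set" for g
    proof -
      \<comment> \<open>The arrow \<open>h\<close> links \<open>g\<close> to the identity of
        \<open>x\<close>: it shares its source with \<open>g\<close> and its target with the
        identity.\<close>
      obtain h where h: "h \<in> arrow_set" "source G h = source G g" "target G h = x"
        using j x source_in[OF g] unfolding joined_def by blast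
      have "dim (end_velocities g) = dim (end_velocities h)"
        using g h by (intro dim_end_velocities_same_source) auto
      also have "\<dots> = r"
        unfolding r_def using h x ident_in target_ident by (intro dim_end_velocities_same_target) auto
      finally show ?thesis .
    qed
    moreover have "ends ` arrow_set = B \<times> B"
      using j source_in target_in unfolding joined_def ends_def by force
    ultimately have "r = DIM('m \<times> 'm)"
      using ident_in[OF x] by (intro dim_end_velocities_if_ends_onto) auto
    then have "dim (end_velocities (ident G x)) = dim (UNIV :: ('m \<times> 'm) set)"
      by (simp add: r_def)
    then show "end_velocities (ident G x) = UNIV"
      using subspace_end_velocities[OF ident_in[OF x]] by (intro subspace_dim_equal) auto
  qed
next
  assume "transitive_algebroid (lie_algebroid G)"
  then show "\<forall>x\<in>B. \<forall>y\<in>B. joined x y" using joined_if_transitive_algebroid[OF assms] by blast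
qed

end

section \<open>Application to the material groupoid\<close>

theorem proposition5p2:
  fixes B :: "(real ^ 3) set"
    and W :: "3 jet \<Rightarrow> 'v::real_normed_vector"
    and T :: "3 jet topology"
  assumes "connected B"
    and "simple_body B W"
    and "topspace T = material_isomorphisms B W"
    and "lie_subgroupoid (material_groupoid B T) (jet_groupoid B)"
  shows "uniform_body B W \<longleftrightarrow> transitive_algebroid (lie_algebroid (material_groupoid B T))"
proof -
  have fields: "arrows (material_groupoid B T) = T" "objects (material_groupoid B T) = top_of_set B"
    "source (material_groupoid B T) = jet_source" "target (material_groupoid B T) = jet_target"
    by (simp_all add: material_groupoid_def jet_groupoid_def)
  interpret linear_lie_groupoid "material_groupoid B T" B
  proof
    show "lie_groupoid (material_groupoid B T)" using assms(4) by (simp add: lie_subgroupoid_def)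
    show "open B" using assms(2) by (simp add: simple_body_def)
  qed (auto simp: fields linear_iff)
  show ?thesis
    \<comment> \<open>Since the arrows are exactly the material isomorphisms, uniformity says that
      any two points of \<open>B\<close> are joined.\<close>
    using joined_iff_transitive_algebroid[OF assms(1)]
    unfolding joined_def fields uniform_body_def assms(3) .
qed

end
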